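(* For $k\in\mathbb{N}$, let $\Phi_k:\mathcal{K}_c(\mathbb{R}^d)\to\mathbb{R}$ be lower semicontinuous mappings which satisfy $$\lim_{k\to\infty}\sup_{C\in\mathcal{M}_k}|\Phi(C)-\Phi_k(C)|=0,$$ let the constraints $\Psi_k:\mathcal{K}_c(\mathbb{R}^d)\to\mathbb{R}^m$ be defined by $\Psi_k(C):=\Psi(C)-L\kappa_{A_k}\|\hat C\|_2\mathbf{1}_{\mathbb{R}^m}$, and assume that $\mathcal{M}\neq\emptyset$. Then $\mathrm{argmin}_{C\in\mathcal{M}}\Phi(C)\neq\emptyset$, and $$\lim_{k\to\infty}\mathcal{D}\big(\mathrm{argmin}_{C\in\mathcal{M}_k}\Phi_k(C),\ \mathrm{argmin}_{C\in\mathcal{M}}\Phi(C)\big)=0.$$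
   Context: $\mathcal{K}_c(\mathbb{R}^d)$ is the space of all nonempty convex compact subsets of $\mathbb{R}^d$, equipped with the Hausdorff distance $\mathrm{dist}_H(C,\tilde C):=\max\{\sup_{c\in C}\inf_{\tilde c\in\tilde C}\|c-\tilde c\|_2,\ \sup_{\tilde c\in\tilde C}\inf_{c\in C}\|c-\tilde c\|_2\}$ (the same formula is used for nonempty closed convex sets). Continuity, convergence and lower semicontinuity (i.e. $\liminf_j\Phi(C_j)\ge\Phi(C)$ whenever $\mathrm{dist}_H(C_j,C)\to0$) are with respect to $\mathrm{dist}_H$. Put $\|C\|_2:=\sup_{c\in C}\|c\|_2$ and $\sigma_C(x):=\sup_{c\in C}x^Tc$. $\mathbf{1}_{\mathbb{R}^m}=(1,\ldots,1)^T\in\mathbb{R}^m$; vector inequalities are componentwise; $\mathbb{N}$ includes $0$. All matrices $A\in\mathbb{R}^{N\times d}$ considered have pairwise distinct rows $a_1^T,\ldots,a_N^T$ with $\|a_i\|_2=1$. For such $A$ put $Q_{A,b}:=\{x\in\mathbb{R}^d:Ax\le b\}$ for $b\in\mathbb{R}^N$, $\mathcal{G}_A:=\{Q_{A,b}:b\in\mathbb{R}^N\}\setminus\{\emptyset\}$, $Q_{A,c}^*:=\{p\in\mathbb{R}^N:p\ge0,\ A^Tp=c\}$ for $c\in\mathbb{R}^d$, $I_p^*:=\{i:p_i>0\}$, $P_{\mathcal{G}_A}(C):=Q_{A,(\sigma_C(a_1),\ldots,\sigma_C(a_N))^T}$ for $C\in\mathcal{K}_c(\mathbb{R}^d)$,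 and $$\kappa_A:=\sup_{\|c\|_2=1}\ \inf\Big\{\sum_{k\in I_p^*}p_k\Big\|a_k-\frac{c}{\|p\|_1}\Big\|_2:\ p\in Q_{A,c}^*\Big\}.$$ A sequence $(A_k)_{k=0}^\infty$ of such matrices $A_k\in\mathbb{R}^{N_k\times d}$ is a nested Galerkin sequence if $A_k$ is a submatrix of $A_{k+1}$ (obtained by deleting rows) for all $k$, and there is a sequence $(\alpha_k)_{k=0}^\infty$ in $[0,\infty)$ with $\alpha_k\to0$ and $\inf_{\tilde C\in\mathcal{G}_{A_k}}\mathrm{dist}_H(C,\tilde C)\le\alpha_k\|C\|_2$ for all $C\in\mathcal{K}_c(\mathbb{R}^d)$ and all $k$. Standing setting: fix a continuous functional $\Phi:\mathcal{K}_c(\mathbb{R}^d)\to\mathbb{R}$, an $L$-Lipschitz map $\Psi:(\mathcal{K}_c(\mathbb{R}^d),\mathrm{dist}_H)\to(\mathbb{R}^m,\|\cdot\|_\infty)$, sets $\check C,\hat C\in\mathcal{K}_c(\mathbb{R}^d)$, and a nested Galerkin sequence $(A_k)_{k=0}^\infty$. Put $$\mathcal{M}:=\{C\in\mathcal{K}_c(\mathbb{R}^d):\Psi(C)\le0,\ \check C\subset C\subset\hat C\},$$ $$\mathcal{M}_k:=\{C\in\mathcal{G}_{A_k}:\Psi_k(C)\le0,\ P_{\mathcal{G}_{A_k}}(\check C)\subset C\subset P_{\mathcal{G}_{A_k}}(\hat C)\}.$$ For sets $\mathcal{N},\tilde{\mathcal{N}}\subset\mathcal{K}_c(\mathbb{R}^d)$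 put $\mathcal{D}(\mathcal{N},\tilde{\mathcal{N}}):=\sup_{C\in\mathcal{N}}\inf_{\tilde C\in\tilde{\mathcal{N}}}\mathrm{dist}_H(C,\tilde C)$. $\mathrm{argmin}$ denotes the set of global minimizers. *)

theory Defs
  imports "HOL-Analysis.Analysis" "HOL-Library.Sublist"
begin

definition convex_bodies :: "(real^'d) set set" where
  "convex_bodies = {C. C \<noteq> {} \<and> convex C \<and> compact C}"

(* Extended-real valued, because polyhedra from the Galerkin spaces below may be unbounded. *)
definition dist_H :: "(real^'d) set \<Rightarrow> (real^'d) set \<Rightarrow> ereal" where
  "dist_H C D = max (SUP c\<in>C. INF d\<in>D. ereal (norm (c - d)))
                    (SUP d\<in>D. INF c\<in>C. ereal (norm (c - d)))"

(* The real-valued suprema in set_norm and support_fun are only meaningful for nonempty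
   bounded sets; they are only applied to convex bodies. *)
definition set_norm :: "(real^'d) set \<Rightarrow> real" where
  "set_norm C = (SUP c\<in>C. norm c)"

definition support_fun :: "(real^'d) set \<Rightarrow> real^'d \<Rightarrow> real" where
  "support_fun C x = (SUP c\<in>C. x \<bullet> c)"

definition continuous_H :: "((real^'d) set \<Rightarrow> real) \<Rightarrow> bool" where
  "continuous_H F \<longleftrightarrow>
    (\<forall>C\<in>convex_bodies. \<forall>\<epsilon>>0. \<exists>\<delta>>0. \<forall>D\<in>convex_bodies.
       dist_H D C < ereal \<delta> \<longrightarrow> \<bar>F D - F C\<bar> < \<epsilon>)"

definition lsc_H :: "((real^'d) set \<Rightarrow> real) \<Rightarrow> bool" where
  "lsc_H F \<longleftrightarrow>
    (\<forall>C\<in>convex_bodies. \<forall>S. (\<forall>j. S j \<in> convex_bodies) \<longrightarrow>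
       (\<lambda>j. dist_H (S j) C) \<longlonglongrightarrow> 0 \<longrightarrow>
       ereal (F C) \<le> liminf (\<lambda>j. ereal (F (S j))))"

definition lipschitz_H :: "real \<Rightarrow> ((real^'d) set \<Rightarrow> real^'m) \<Rightarrow> bool" where
  "lipschitz_H L F \<longleftrightarrow> 0 \<le> L \<and>
    (\<forall>C\<in>convex_bodies. \<forall>D\<in>convex_bodies.
       ereal (infnorm (F C - F D)) \<le> ereal L * dist_H C D)"

(* A matrix with N rows in R^d, where N varies, is represented by the list of its rows;
   vectors in R^N are lists of length N.  Deleting rows then means taking a subsequence. *)
definition normalized_matrix :: "(real^'d) list \<Rightarrow> bool" where
  "normalized_matrix A \<longleftrightarrow> distinct A \<and> (\<forall>a\<in>set A. norm a = 1)"

definition polyhedron_of :: "(real^'d) list \<Rightarrow> real list \<Rightarrow> (real^'d) set" where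
  "polyhedron_of A b = {x. \<forall>i<length A. (A ! i) \<bullet> x \<le> b ! i}"

definition galerkin_space :: "(real^'d) list \<Rightarrow> (real^'d) set set" where
  "galerkin_space A = {polyhedron_of A b | b. length b = length A} - {{}}"

definition dual_polyhedron :: "(real^'d) list \<Rightarrow> real^'d \<Rightarrow> real list set" where
  "dual_polyhedron A c = {p. length p = length A \<and> (\<forall>i<length A. 0 \<le> p ! i) \<and>
                             (\<Sum>i<length A. (p ! i) *\<^sub>R (A ! i)) = c}"

definition positive_indices :: "real list \<Rightarrow> nat set" where
  "positive_indices p = {i. i < length p \<and> 0 < p ! i}"

definition galerkin_proj :: "(real^'d) list \<Rightarrow> (real^'d) set \<Rightarrow> (real^'d) set" where
  "galerkin_proj A C = polyhedron_of A (map (support_fun C) A)"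

(* Extended-real valued: infinite if some dual polyhedron is empty. *)
definition galerkin_kappa :: "(real^'d) list \<Rightarrow> ereal" where
  "galerkin_kappa A = (SUP c\<in>{c. norm c = 1}. INF p\<in>dual_polyhedron A c.
     ereal (\<Sum>k\<in>positive_indices p.
              p ! k * norm (A ! k - (1 / (\<Sum>i<length p. \<bar>p ! i\<bar>)) *\<^sub>R c)))"

definition nested_galerkin :: "(nat \<Rightarrow> (real^'d) list) \<Rightarrow> bool" where
  "nested_galerkin A \<longleftrightarrow>
    (\<forall>k. normalized_matrix (A k)) \<and>
    (\<forall>k. subseq (A k) (A (Suc k))) \<and>
    (\<exists>\<alpha>::nat \<Rightarrow> real. (\<forall>k. 0 \<le> \<alpha> k) \<and> \<alpha> \<longlonglongrightarrow> 0 \<and>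
       (\<forall>k. \<forall>C\<in>convex_bodies.
          (INF D\<in>galerkin_space (A k). dist_H C D) \<le> ereal (\<alpha> k * set_norm C)))"

definition feasible_set ::
    "((real^'d) set \<Rightarrow> real^'m) \<Rightarrow> (real^'d) set \<Rightarrow> (real^'d) set \<Rightarrow> (real^'d) set set" where
  "feasible_set \<Psi> Clo Chi = {C \<in> convex_bodies. \<Psi> C \<le> 0 \<and> Clo \<subseteq> C \<and> C \<subseteq> Chi}"

definition galerkin_feasible_set ::
    "(real^'d) list \<Rightarrow> ((real^'d) set \<Rightarrow> real^'m) \<Rightarrow> (real^'d) set \<Rightarrow> (real^'d) set \<Rightarrow> (real^'d) set set"
  where
  "galerkin_feasible_set A \<Psi> Clo Chi =
    {C \<in> galerkin_space A. \<Psi> C \<le> 0 \<and> galerkin_proj A Clo \<subseteq> C \<and> C \<subseteq> galerkin_proj A Chi}"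

(* Extended-real suprema and infima, so the excess of the empty family is minus infinity and
   the excess of a nonempty family over the empty one is plus infinity. *)
definition excess_H :: "(real^'d) set set \<Rightarrow> (real^'d) set set \<Rightarrow> ereal" where
  "excess_H N M = (SUP C\<in>N. INF D\<in>M. dist_H C D)"

definition argmin_set :: "('a \<Rightarrow> real) \<Rightarrow> 'a set \<Rightarrow> 'a set" where
  "argmin_set f S = {x. is_arg_min f (\<lambda>y. y \<in> S) x}"

end

theory Submission
  imports Defs "HOL-Complex_Analysis.Great_Picard"
begin

text \<open>
The proof is a compactness argument: any Hausdorff limit \<open>C\<close> of discrete minimizers \<open>C\<^sub>k\<close> is a minimizer of the
limit problem, and bounded sequences of convex bodies have Hausdorff convergent subsequences
(\<open>blaschke_selection\<close>). If discrete minimizers stayed at distance more than \<open>e\<close> from all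
minimizers for infinitely many \<open>k\<close>, a convergent subsequence of them would contradict this.

The limit is optimal (\<open>galerkin_minimizers_limit\<close>) because every feasible \<open>D\<close> has the discrete
feasible approximations \<open>P\<^sub>k D\<close>, where \<open>P\<^sub>k\<close> is the projection onto the \<open>k\<close>-th Galerkin space:
up to errors that vanish, \<open>\<Phi> C\<^sub>k \<le> \<Phi> (P\<^sub>k D)\<close>, and \<open>P\<^sub>k D\<close> tends to \<open>D\<close>. The relaxation by
\<open>L * \<kappa>\<^sub>k * \<parallel>Chi\<parallel>\<close> in the discrete constraint is what keeps \<open>P\<^sub>k D\<close> feasible, since \<open>P\<^sub>k D\<close> lies within
\<open>\<kappa>\<^sub>k * \<parallel>D\<parallel>\<close> of \<open>D\<close> (\<open>galerkin_proj_error\<close>): a dual vector that represents a direction \<open>c\<close> by rows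
of the matrix bounds the support function of the projection in direction \<open>c\<close>.

Two facts concern the matrices. First, \<open>\<kappa>\<^sub>k\<close> tends to \<open>0\<close> for a Galerkin sequence
(\<open>nested_galerkin_kappa_tendsto_0\<close>). It suffices to look at the approximation of the unit
ball: if some polyhedron of the Galerkin space is within \<open>\<beta> < 1\<close> of it, then the polyhedron
\<open>{x. a \<bullet> x \<le> 1 for all rows a}\<close> lies in the ball of radius \<open>R = (1 + \<beta>) / (1 - \<beta>)\<close>; by separation
every unit vector is a combination of rows with nonnegative weights of total mass at most
\<open>R\<close>, and by Cauchy-Schwarz such weights have cost at most \<open>sqrt (R\<^sup>2 - 1)\<close>.
Second, Galerkin spaces are closed under Hausdorff limits (\<open>galerkin_space_closed\<close>), so
that the discrete feasible families are compact and lower semicontinuous functionals attain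
their minimum on them. For large \<open>k\<close> the sets of discrete minimizers are therefore nonempty,
without which the excess would be \<open>-\<infinity>\<close> and not tend to \<open>0\<close>.
\<close>

section \<open>Hausdorff convergence\<close>

text \<open>A real-valued, attained form of the bound \<open>dist_H C D \<le> e\<close>. It follows from the strict
inequality and implies the weak one (\<open>dist_H_lessD\<close> and \<open>dist_H_le\<close>), which is enough for limits
and avoids arithmetic with extended reals.\<close>

definition hausdorff_within :: "real \<Rightarrow> (real^'d) set \<Rightarrow> (real^'d) set \<Rightarrow> bool" where
  "hausdorff_within e C D \<longleftrightarrow> (\<forall>x\<in>C. \<exists>y\<in>D. dist x y \<le> e) \<and> (\<forall>y\<in>D. \<exists>x\<in>C. dist x y \<le> e)"

lemma hausdorff_within_sym: "hausdorff_within e C D \<longleftrightarrow> hausdorff_within e D C"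
  unfolding hausdorff_within_def by (auto simp: dist_commute)

lemma hausdorff_within_mono: "hausdorff_within d C D \<Longrightarrow> d \<le> e \<Longrightarrow> hausdorff_within e C D"
  unfolding hausdorff_within_def by (blast intro: order_trans)

lemma dist_H_le:
  assumes "hausdorff_within e C D"
  shows "dist_H C D \<le> ereal e"
  unfolding dist_H_def
proof (rule max.boundedI; rule SUP_least)
  fix c assume "c \<in> C"
  then obtain d where "d \<in> D" "norm (c - d) \<le> e"
    using assms by (auto simp: hausdorff_within_def dist_norm)
  then show "(INF d\<in>D. ereal (norm (c - d))) \<le> ereal e"
    by (meson INF_lower2 ereal_less_eq(3))
next
  fix d assume "d \<in> D"
  then obtain c where "c \<in> C" "norm (c - d) \<le> e"
    using assms by (auto simp: hausdorff_within_def dist_norm)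
  then show "(INF c\<in>C. ereal (norm (c - d))) \<le> ereal e"
    by (meson INF_lower2 ereal_less_eq(3))
qed

lemma dist_H_lessD:
  assumes "dist_H C D < ereal e"
  shows "hausdorff_within e C D"
  unfolding hausdorff_within_def
proof (intro conjI ballI)
  fix c assume "c \<in> C"
  then have "(INF d\<in>D. ereal (norm (c - d))) \<le> dist_H C D"
    unfolding dist_H_def by (intro max.coboundedI1 SUP_upper)
  then have "(INF d\<in>D. ereal (norm (c - d))) < ereal e"
    using assms by simp
  then show "\<exists>y\<in>D. dist c y \<le> e"
    by (auto simp: INF_less_iff dist_norm intro: less_imp_le)
next
  fix d assume "d \<in> D"
  then have "(INF c\<in>C. ereal (norm (c - d))) \<le> dist_H C D"
    unfolding dist_H_def by (intro max.coboundedI2 SUP_upper)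
  then have "(INF c\<in>C. ereal (norm (c - d))) < ereal e"
    using assms by simp
  then show "\<exists>x\<in>C. dist x d \<le> e"
    by (auto simp: INF_less_iff dist_norm intro: less_imp_le)
qed

lemma dist_H_nonneg:
  assumes "C \<noteq> {}"
  shows "0 \<le> dist_H C D"
proof -
  obtain c where "c \<in> C" using assms by blast
  have "0 \<le> (INF d\<in>D. ereal (norm (c - d)))"
    by (rule INF_greatest) simp
  also have "\<dots> \<le> dist_H C D"
    unfolding dist_H_def using \<open>c \<in> C\<close> by (intro max.coboundedI1 SUP_upper)
  finally show ?thesis .
qed

lemma dist_H_tendsto_0_iff:
  assumes "\<And>j. S j \<noteq> {}"
  shows "((\<lambda>j. dist_H (S j) C) \<longlongrightarrow> 0) F \<longleftrightarrow> (\<forall>e>0. eventually (\<lambda>j. hausdorff_within e (S j) C) F)"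
proof
  assume lim: "((\<lambda>j. dist_H (S j) C) \<longlongrightarrow> 0) F"
  show "\<forall>e>0. eventually (\<lambda>j. hausdorff_within e (S j) C) F"
  proof (intro allI impI)
    fix e :: real assume "e > 0"
    then have "eventually (\<lambda>j. dist_H (S j) C < ereal e) F"
      using order_tendstoD(2)[OF lim, of "ereal e"] by (simp add: zero_ereal_def)
    then show "eventually (\<lambda>j. hausdorff_within e (S j) C) F"
      by (rule eventually_mono) (rule dist_H_lessD)
  qed
next
  assume within: "\<forall>e>0. eventually (\<lambda>j. hausdorff_within e (S j) C) F"
  show "((\<lambda>j. dist_H (S j) C) \<longlongrightarrow> 0) F"
  proof (rule order_tendstoI)
    fix a :: ereal assume "a < 0"
    then show "eventually (\<lambda>j. a < dist_H (S j) C) F"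
      using assms by (auto intro!: always_eventually less_le_trans[OF _ dist_H_nonneg])
  next
    fix a :: ereal assume "0 < a"
    then obtain e where e: "0 < ereal e" "ereal e < a"
      using ereal_dense2 by blast
    then have "eventually (\<lambda>j. hausdorff_within e (S j) C) F"
      using within by (simp add: zero_ereal_def)
    then show "eventually (\<lambda>j. dist_H (S j) C < a) F"
      by (rule eventually_mono) (use e(2) dist_H_le le_less_trans in blast)
  qed
qed

lemma hausdorff_within_limit_mem:
  assumes C: "closed C" and near: "\<And>e. e > 0 \<Longrightarrow> \<exists>y\<in>C. dist x y \<le> e"
  shows "x \<in> C"
proof -
  have "\<exists>y\<in>C. dist y x < e" if "e > 0" for e
    using near[of "e/2"] that by (force simp: dist_commute)
  then show ?thesis
    using C by (metis closed_approachable)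
qed

lemma convex_bodiesD:
  assumes "C \<in> convex_bodies"
  shows "C \<noteq> {}" "convex C" "compact C" "closed C" "bounded C"
  using assms by (auto simp: convex_bodies_def compact_imp_closed compact_imp_bounded)

lemma hausdorff_limitD:
  assumes "\<And>j. S j \<in> convex_bodies" "(\<lambda>j. dist_H (S j) C) \<longlonglongrightarrow> 0" "e > 0"
  shows "\<forall>\<^sub>F j in sequentially. hausdorff_within e (S j) C"
  using assms(2,3) convex_bodiesD(1)[OF assms(1)] by (subst (asm) dist_H_tendsto_0_iff) auto

lemma hausdorff_limit_point:
  assumes S: "\<And>j. S j \<in> convex_bodies" and S_lim: "(\<lambda>j. dist_H (S j) C) \<longlonglongrightarrow> 0"
    and "closed C" and mem: "\<forall>\<^sub>F j in sequentially. z j \<in> S j" and lim: "z \<longlonglongrightarrow> l"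
  shows "l \<in> C"
proof (rule hausdorff_within_limit_mem[OF \<open>closed C\<close>])
  fix e :: real assume "e > 0"
  then have "\<forall>\<^sub>F j in sequentially. dist (z j) l < e/2"
    using lim by (intro tendstoD) simp_all
  with hausdorff_limitD[OF S S_lim half_gt_zero[OF \<open>e > 0\<close>]] mem
  have "\<forall>\<^sub>F j in sequentially. \<exists>y\<in>C. dist l y \<le> e"
  proof eventually_elim
    case (elim j)
    then obtain y where "y \<in> C" "dist (z j) y \<le> e/2"
      by (auto simp: hausdorff_within_def)
    then show ?case
      using elim(3) dist_triangle[of l y "z j"] by (intro bexI[of _ y]) (auto simp: dist_commute)
  qed
  then show "\<exists>y\<in>C. dist l y \<le> e"
    by (simp add: eventually_const)
qed

text \<open>Every point of a limit set is the limit of its nearest points in the approximating sets. Together with \<open>hausdorff_limit_point\<close> this lets inclusions and polyhedral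
constraints pass to the limit.\<close>

lemma hausdorff_recovery_sequence:
  assumes S: "\<And>j. S j \<in> convex_bodies" and S_lim: "(\<lambda>j. dist_H (S j) C) \<longlonglongrightarrow> 0"
    and y: "y \<in> C"
  obtains ys where "\<And>j. ys j \<in> S j" "ys \<longlonglongrightarrow> y"
proof
  define ys where "ys = (\<lambda>j. closest_point (S j) y)"
  show "ys j \<in> S j" for j
    unfolding ys_def by (intro closest_point_in_set convex_bodiesD S)
  show "ys \<longlonglongrightarrow> y"
  proof (rule tendstoI)
    fix e :: real assume "e > 0"
    from hausdorff_limitD[OF S S_lim half_gt_zero[OF this]]
    show "\<forall>\<^sub>F j in sequentially. dist (ys j) y < e"
    proof eventually_elim
      case (elim j)
      then obtain s where "s \<in> S j" "dist s y \<le> e/2"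
        using y by (auto simp: hausdorff_within_def)
      then have "dist (ys j) y \<le> e/2"
        using closest_point_le[OF convex_bodiesD(4)[OF S[of j]], of s y]
        by (simp add: ys_def dist_commute)
      then show ?case using \<open>e > 0\<close> by simp
    qed
  qed
qed

lemma hausdorff_limit_mono:
  assumes S: "\<And>j. S j \<in> convex_bodies" "(\<lambda>j. dist_H (S j) C) \<longlonglongrightarrow> 0"
    and T: "\<And>j. T j \<in> convex_bodies" "(\<lambda>j. dist_H (T j) D) \<longlonglongrightarrow> 0"
    and "closed D" and sub: "\<And>j. S j \<subseteq> T j"
  shows "C \<subseteq> D"
proof
  fix x assume "x \<in> C"
  then obtain ys where "\<And>j. ys j \<in> S j" "ys \<longlonglongrightarrow> x"
    using hausdorff_recovery_sequence[OF S] by blast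
  then show "x \<in> D"
    using sub by (intro hausdorff_limit_point[OF T \<open>closed D\<close>, of ys] always_eventually) blast+
qed

section \<open>Compactness of bounded families of convex bodies\<close>

text \<open>Blaschke's selection theorem. The distance functions of the sets are \<open>1\<close>-Lipschitz and
uniformly bounded, so by Arzela-Ascoli a subsequence converges uniformly on the ball to some
\<open>g\<close>. The limit body is the zero set of \<open>g\<close>: nearest points accumulate there, so that its distance
function is at most \<open>g\<close>, and this turns uniform convergence into Hausdorff convergence.\<close>

theorem blaschke_selection:
  fixes S :: "nat \<Rightarrow> (real^'d) set"
  assumes S: "\<And>j. S j \<in> convex_bodies" and SR: "\<And>j. S j \<subseteq> cball 0 R"
  obtains C r where "C \<in> convex_bodies" "strict_mono (r :: nat \<Rightarrow> nat)"
    "(\<lambda>j. dist_H (S (r j)) C) \<longlonglongrightarrow> 0"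
proof -
  define B :: "(real^'d) set" where "B = cball 0 R"
  have ne: "S j \<noteq> {}" and cl: "closed (S j)" for j
    using S convex_bodiesD by blast+
  have SB: "x \<in> B" if "x \<in> S j" for x j
    using SR that unfolding B_def by blast
  have bound: "norm (infdist x (S j)) \<le> 2 * R" if "x \<in> B" for j x
  proof -
    obtain s where s: "s \<in> S j" using ne by blast
    then have "norm s \<le> R" using SR by fastforce
    have "infdist x (S j) \<le> dist x s"
      using s by (rule infdist_le)
    also have "\<dots> \<le> norm x + norm s"
      by (simp add: dist_norm norm_triangle_ineq4)
    finally show ?thesis
      using that \<open>norm s \<le> R\<close> by (simp add: B_def infdist_nonneg)
  qed
  have equi: "\<exists>d. 0 < d \<and> (\<forall>n y. y \<in> B \<and> norm (x - y) < d \<longrightarrow> norm (infdist x (S n) - infdist y (S n)) < e)"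
    if "0 < e" for x and e :: real
    using that infdist_triangle_abs[of x _ y for y]
    by (intro exI[of _ e]) (auto simp: dist_norm intro: le_less_trans[OF infdist_triangle_abs])
  obtain g r where g: "continuous_on B g" and r: "strict_mono (r :: nat \<Rightarrow> nat)"
    and unif: "\<And>e. 0 < e \<Longrightarrow> \<exists>N. \<forall>n x. n \<ge> N \<and> x \<in> B \<longrightarrow> norm (infdist x (S (r n)) - g x) < e"
    by (rule Arzela_Ascoli[of B "\<lambda>n x. infdist x (S n)" "2 * R"])
       (use bound equi in \<open>auto simp: B_def\<close>)
  have lim: "(\<lambda>n. infdist x (S (r n))) \<longlonglongrightarrow> g x" if "x \<in> B" for x
    using unif that by (fastforce simp: LIMSEQ_def dist_norm)
  define C where "C = {x \<in> B. g x = 0}"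
  have g_nonneg: "0 \<le> g x" if "x \<in> B" for x
    using lim[OF that] by (rule LIMSEQ_le_const) (simp add: infdist_nonneg)
  have attained: "\<exists>y\<in>C. dist x y \<le> g x" if x: "x \<in> B" for x
  proof -
    have "\<exists>y\<in>S (r n). infdist x (S (r n)) = dist x y" for n
      using infdist_attains_inf[OF cl ne] by metis
    then obtain y where y: "\<And>n. y n \<in> S (r n)" "\<And>n. infdist x (S (r n)) = dist x (y n)"
      by metis
    have "y n \<in> B" for n using y(1) by (rule SB)
    then obtain l q where l: "l \<in> B" "strict_mono (q :: nat \<Rightarrow> nat)" "(y \<circ> q) \<longlonglongrightarrow> l"
      using compact_cball[of "0::real^'d" R] unfolding B_def compact_def by metis
    have "(\<lambda>n. infdist x (S (r (q n)))) \<longlonglongrightarrow> g x"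
      using LIMSEQ_subseq_LIMSEQ[OF lim[OF x] l(2)] by (simp add: o_def)
    moreover have "(\<lambda>n. dist x (y (q n))) \<longlonglongrightarrow> dist x l"
      using l(3) by (intro tendsto_intros) (simp add: o_def)
    ultimately have "g x = dist x l"
      using y(2) LIMSEQ_unique by simp
    moreover have "g l = 0"
    proof (rule LIMSEQ_unique)
      show "(\<lambda>n. infdist l (S (r (q n)))) \<longlonglongrightarrow> g l"
        using LIMSEQ_subseq_LIMSEQ[OF lim[OF l(1)] l(2)] by (simp add: o_def)
      have "(\<lambda>n. dist l (y (q n))) \<longlonglongrightarrow> 0"
        using tendsto_dist[OF tendsto_const[of l] l(3)] by (simp add: o_def)
      then show "(\<lambda>n. infdist l (S (r (q n)))) \<longlonglongrightarrow> 0"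
        by (rule Lim_null_comparison[rotated]) (simp add: infdist_nonneg infdist_le y(1))
    qed
    ultimately show ?thesis using l(1) by (auto simp: C_def)
  qed
  have "C \<in> convex_bodies"
    unfolding convex_bodies_def
  proof (intro CollectI conjI)
    obtain s where "s \<in> S 0" using ne by blast
    then have "s \<in> B" by (rule SB)
    then show "C \<noteq> {}" using attained by blast
    have "closed C"
      unfolding C_def using g by (intro continuous_closed_preimage_constant) (auto simp: B_def)
    moreover have "C \<subseteq> B" by (auto simp: C_def)
    ultimately show "compact C"
      by (metis B_def bounded_cball bounded_subset compact_eq_bounded_closed)
    show "convex C"
    proof (rule convexI)
      fix x y and u v :: real
      assume xy: "x \<in> C" "y \<in> C" and uv: "0 \<le> u" "0 \<le> v" "u + v = 1"
      let ?z = "u *\<^sub>R x + v *\<^sub>R y"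
      have z: "?z \<in> B"
        using xy uv convexD[OF convex_cball, of x 0 R y u v] by (simp add: C_def B_def)
      have "infdist ?z (S (r n)) \<le> u * infdist x (S (r n)) + v * infdist y (S (r n))" for n
      proof -
        obtain a where a: "a \<in> S (r n)" "infdist x (S (r n)) = dist x a"
          using infdist_attains_inf[OF cl ne] by metis
        obtain b where b: "b \<in> S (r n)" "infdist y (S (r n)) = dist y b"
          using infdist_attains_inf[OF cl ne] by metis
        have "u *\<^sub>R a + v *\<^sub>R b \<in> S (r n)"
          using convexD[OF convex_bodiesD(2)[OF S] a(1) b(1) uv] .
        then have "infdist ?z (S (r n)) \<le> dist ?z (u *\<^sub>R a + v *\<^sub>R b)"
          by (rule infdist_le)
        also have "\<dots> = norm (u *\<^sub>R (x - a) + v *\<^sub>R (y - b))"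
          by (simp add: dist_norm algebra_simps)
        also have "\<dots> \<le> u * dist x a + v * dist y b"
          using norm_triangle_ineq[of "u *\<^sub>R (x - a)" "v *\<^sub>R (y - b)"] uv by (simp add: dist_norm)
        finally show ?thesis using a b by simp
      qed
      moreover have "(\<lambda>n. u * infdist x (S (r n)) + v * infdist y (S (r n))) \<longlonglongrightarrow> u * g x + v * g y"
        using xy by (intro tendsto_intros lim) (auto simp: C_def)
      ultimately have "g ?z \<le> u * g x + v * g y"
        using lim[OF z] by (meson LIMSEQ_le)
      then show "?z \<in> C"
        using xy z g_nonneg[OF z] by (simp add: C_def)
    qed
  qed
  moreover have "(\<lambda>j. dist_H (S (r j)) C) \<longlonglongrightarrow> 0"
    unfolding dist_H_tendsto_0_iff[OF ne]
  proof (intro allI impI)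
    fix e :: real assume "e > 0"
    then obtain N where N: "\<And>n x. n \<ge> N \<Longrightarrow> x \<in> B \<Longrightarrow> \<bar>infdist x (S (r n)) - g x\<bar> < e"
      using unif[of e] by auto
    have "hausdorff_within e (S (r n)) C" if "n \<ge> N" for n
      unfolding hausdorff_within_def
    proof (intro conjI ballI)
      fix x assume x: "x \<in> S (r n)"
      then have "x \<in> B" by (rule SB)
      moreover from this have "g x \<le> e"
        using N[OF that] x by force
      ultimately show "\<exists>y\<in>C. dist x y \<le> e"
        using attained by force
    next
      fix y assume "y \<in> C"
      then have "infdist y (S (r n)) \<le> e"
        using N[OF that, of y] by (simp add: C_def)
      then show "\<exists>x\<in>S (r n). dist x y \<le> e"
        using infdist_attains_inf[OF cl ne, of "r n" y] by (metis dist_commute)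
    qed
    then show "\<forall>\<^sub>F j in sequentially. hausdorff_within e (S (r j)) C"
      using eventually_sequentially by blast
  qed
  ultimately show ?thesis using that r by blast
qed

section \<open>Support functions and polyhedra with prescribed normals\<close>

lemma bdd_above_inner:
  assumes "C \<in> convex_bodies"
  shows "bdd_above ((\<lambda>c. x \<bullet> c) ` C)"
proof -
  have "compact ((\<lambda>c. x \<bullet> c) ` C)"
    using assms by (intro compact_continuous_image continuous_intros) (auto simp: convex_bodiesD)
  then show ?thesis
    by (intro bounded_imp_bdd_above compact_imp_bounded)
qed

lemma support_fun_upper:
  assumes "C \<in> convex_bodies" "c \<in> C"
  shows "x \<bullet> c \<le> support_fun C x"
  unfolding support_fun_def by (intro cSUP_upper assms bdd_above_inner)

lemma support_fun_least:
  assumes "C \<in> convex_bodies" "\<And>c. c \<in> C \<Longrightarrow> x \<bullet> c \<le> t"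
  shows "support_fun C x \<le> t"
  unfolding support_fun_def using assms by (intro cSUP_least) (auto simp: convex_bodiesD)

lemma norm_le_set_norm:
  assumes "C \<in> convex_bodies" "c \<in> C"
  shows "norm c \<le> set_norm C"
proof -
  have "bdd_above (norm ` C)"
    using convex_bodiesD(5)[OF assms(1)] by (auto simp: bounded_iff bdd_above_def)
  then show ?thesis
    unfolding set_norm_def by (intro cSUP_upper assms)
qed

lemma set_norm_nonneg: "C \<in> convex_bodies \<Longrightarrow> 0 \<le> set_norm C"
  by (metis convex_bodiesD(1) ex_in_conv norm_ge_zero norm_le_set_norm order_trans)

lemma set_norm_mono:
  assumes "C \<in> convex_bodies" "D \<in> convex_bodies" "C \<subseteq> D"
  shows "set_norm C \<le> set_norm D"
  unfolding set_norm_def[of C]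
  by (intro cSUP_least norm_le_set_norm subsetD[OF assms(3)] convex_bodiesD(1) assms(1,2))

lemma support_fun_mono:
  assumes "C \<in> convex_bodies" "D \<in> convex_bodies" "C \<subseteq> D"
  shows "support_fun C x \<le> support_fun D x"
  using assms by (intro support_fun_least support_fun_upper) auto

lemma support_fun_hausdorff_within:
  assumes "C \<in> convex_bodies" "D \<in> convex_bodies" "hausdorff_within e C D" "norm a \<le> 1"
  shows "\<bar>support_fun C a - support_fun D a\<bar> \<le> e"
proof -
  have le: "support_fun C a \<le> support_fun D a + e"
    if C: "C \<in> convex_bodies" and D: "D \<in> convex_bodies" and w: "hausdorff_within e C D" for C D
  proof (rule support_fun_least[OF C])
    fix c assume "c \<in> C"
    then obtain d where d: "d \<in> D" "dist c d \<le> e"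
      using w by (auto simp: hausdorff_within_def)
    have "a \<bullet> c = a \<bullet> d + a \<bullet> (c - d)" by (simp add: inner_diff_right)
    also have "a \<bullet> (c - d) \<le> norm a * norm (c - d)" by (rule norm_cauchy_schwarz)
    also have "\<dots> \<le> 1 * e"
      using assms(4) d by (intro mult_mono) (auto simp: dist_norm)
    finally show "a \<bullet> c \<le> support_fun D a + e"
      using support_fun_upper[OF D d(1), of a] by simp
  qed
  from le[of C D] le[of D C] assms show ?thesis
    by (simp add: hausdorff_within_sym[of e D C])
qed

lemma polyhedron_of_mono:
  assumes "\<And>i. i < length A \<Longrightarrow> b ! i \<le> b' ! i"
  shows "polyhedron_of A b \<subseteq> polyhedron_of A b'"
  using assms by (force simp: polyhedron_of_def)

lemma polyhedron_of_halfspaces: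
  "polyhedron_of A b = (\<Inter>i\<in>{..<length A}. {x. (A ! i) \<bullet> x \<le> b ! i})"
  by (auto simp: polyhedron_of_def)

lemma closed_polyhedron_of: "closed (polyhedron_of A b)"
  unfolding polyhedron_of_halfspaces by (intro closed_INT ballI closed_halfspace_le)

lemma convex_polyhedron_of: "convex (polyhedron_of A b)"
  unfolding polyhedron_of_halfspaces by (intro convex_INT convex_halfspace_le)

lemma galerkin_proj_iff:
  "x \<in> galerkin_proj A C \<longleftrightarrow> (\<forall>a\<in>set A. a \<bullet> x \<le> support_fun C a)"
  by (auto simp: galerkin_proj_def polyhedron_of_def all_set_conv_all_nth)

lemma galerkin_proj_superset:
  assumes "C \<in> convex_bodies"
  shows "C \<subseteq> galerkin_proj A C"
  using assms by (auto simp: galerkin_proj_iff intro: support_fun_upper)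

lemma galerkin_proj_mono:
  assumes "C \<in> convex_bodies" "D \<in> convex_bodies" "C \<subseteq> D"
  shows "galerkin_proj A C \<subseteq> galerkin_proj A D"
  unfolding galerkin_proj_def using support_fun_mono[OF assms] by (intro polyhedron_of_mono) simp

lemma galerkin_proj_in_galerkin_space:
  assumes "C \<in> convex_bodies"
  shows "galerkin_proj A C \<in> galerkin_space A"
  using galerkin_proj_superset[OF assms, of A] convex_bodiesD(1)[OF assms]
  by (auto simp: galerkin_space_def galerkin_proj_def)

lemma galerkin_space_bounded_imp_convex_body:
  assumes "Q \<in> galerkin_space A" "bounded Q"
  shows "Q \<in> convex_bodies"
  using assms by (auto simp: galerkin_space_def convex_bodies_def compact_eq_bounded_closed
      closed_polyhedron_of convex_polyhedron_of)

text \<open>Replacing the right-hand sides of a polyhedron by its support values can only tighten them,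
and does not cut off any of its points.\<close>

lemma galerkin_proj_fixes_galerkin_space:
  assumes "Q \<in> galerkin_space A" "Q \<in> convex_bodies"
  shows "galerkin_proj A Q = Q"
proof
  obtain b where b: "Q = polyhedron_of A b"
    using assms(1) by (auto simp: galerkin_space_def)
  have "support_fun Q (A ! i) \<le> b ! i" if "i < length A" for i
    using assms(2) by (rule support_fun_least) (use that in \<open>auto simp: b polyhedron_of_def\<close>)
  then have "galerkin_proj A Q \<subseteq> polyhedron_of A b"
    unfolding galerkin_proj_def by (intro polyhedron_of_mono) simp
  then show "galerkin_proj A Q \<subseteq> Q" by (simp add: b)
qed (rule galerkin_proj_superset[OF assms(2)])

text \<open>The right-hand sides \<open>support_fun (S j) a\<close> converge to those of the projection of \<open>C\<close>, so it
is to be shown that a point \<open>x\<close> of this projection belongs to \<open>C\<close>. Otherwise let \<open>y\<close> be its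
nearest point in \<open>C\<close>. Points of \<open>S j\<close> that converge to \<open>y\<close> stay in \<open>S j\<close> for large \<open>j\<close> when shifted
by \<open>(x - y) / 2\<close>, which in the limit gives a point of \<open>C\<close> nearer to \<open>x\<close>. The argument also covers
polyhedra with empty interior.\<close>

lemma galerkin_space_closed:
  assumes S: "\<And>j. S j \<in> galerkin_space A" "\<And>j. S j \<in> convex_bodies"
    and C: "C \<in> convex_bodies" and lim: "(\<lambda>j. dist_H (S j) C) \<longlonglongrightarrow> 0"
    and A: "normalized_matrix A"
  shows "C \<in> galerkin_space A"
proof -
  have supp: "(\<lambda>j. support_fun (S j) a) \<longlonglongrightarrow> support_fun C a" if "a \<in> set A" for a
  proof (rule tendstoI)
    fix e :: real assume "e > 0"
    have "norm a \<le> 1" using A that by (auto simp: normalized_matrix_def)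
    from hausdorff_limitD[OF S(2) lim half_gt_zero[OF \<open>e > 0\<close>]]
    show "\<forall>\<^sub>F j in sequentially. dist (support_fun (S j) a) (support_fun C a) < e"
    proof eventually_elim
      case (elim j)
      from support_fun_hausdorff_within[OF S(2) C elim \<open>norm a \<le> 1\<close>] \<open>e > 0\<close>
      show ?case by (simp add: dist_real_def)
    qed
  qed
  have "x \<in> C" if x: "x \<in> galerkin_proj A C" for x
  proof (rule ccontr)
    assume "x \<notin> C"
    define y where "y = closest_point C x"
    have y: "y \<in> C" "\<And>z. z \<in> C \<Longrightarrow> dist x y \<le> dist x z"
      using closest_point_exists[of C x] convex_bodiesD[OF C] by (auto simp: y_def)
    have "x \<noteq> y" using y(1) \<open>x \<notin> C\<close> by blast
    obtain ys where ys: "\<And>j. ys j \<in> S j" and ys_lim: "ys \<longlonglongrightarrow> y"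
      using hausdorff_recovery_sequence[OF S(2) lim y(1)] by blast
    \<comment> \<open>A row constraint that does not increase in the direction \<open>x - y\<close> remains satisfied; one that increases has slack at \<open>y\<close>, which absorbs half of the step.\<close>
    define z where "z = (\<lambda>j. ys j + (1/2) *\<^sub>R (x - y))"
    have "\<forall>\<^sub>F j in sequentially. a \<bullet> z j \<le> support_fun (S j) a" if a: "a \<in> set A" for a
    proof (cases "a \<bullet> (x - y) \<le> 0")
      case True
      have "a \<bullet> z j \<le> support_fun (S j) a" for j
        using support_fun_upper[OF S(2) ys, of a j] True by (simp add: z_def inner_add_right)
      then show ?thesis by simp
    next
      case False
      have "(\<lambda>j. support_fun (S j) a - a \<bullet> z j)
              \<longlonglongrightarrow> support_fun C a - a \<bullet> (y + (1/2) *\<^sub>R (x - y))"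
        unfolding z_def by (intro tendsto_intros supp a ys_lim)
      moreover have "a \<bullet> x \<le> support_fun C a"
        using x a by (simp add: galerkin_proj_iff)
      then have "0 < support_fun C a - a \<bullet> (y + (1/2) *\<^sub>R (x - y))"
        using False by (simp add: inner_add_right inner_diff_right field_simps)
      ultimately have "\<forall>\<^sub>F j in sequentially. 0 < support_fun (S j) a - a \<bullet> z j"
        by (rule order_tendstoD(1))
      then show ?thesis by (rule eventually_mono) simp
    qed
    then have "\<forall>\<^sub>F j in sequentially. \<forall>a\<in>set A. a \<bullet> z j \<le> support_fun (S j) a"
      by (simp add: eventually_ball_finite)
    then have "\<forall>\<^sub>F j in sequentially. z j \<in> S j"
      by (rule eventually_mono)
         (use galerkin_proj_fixes_galerkin_space[OF S] in \<open>simp add: galerkin_proj_iff[symmetric]\<close>)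
    moreover have "z \<longlonglongrightarrow> y + (1/2) *\<^sub>R (x - y)"
      unfolding z_def by (intro tendsto_intros ys_lim)
    ultimately have "y + (1/2) *\<^sub>R (x - y) \<in> C"
      using hausdorff_limit_point[OF S(2) lim convex_bodiesD(4)[OF C]] by blast
    \<comment> \<open>The limit of the shifted points is in \<open>C\<close> but closer to \<open>x\<close> than the nearest point \<open>y\<close>.\<close>
    then have "norm (x - y) \<le> norm (x - (y + (1/2) *\<^sub>R (x - y)))"
      using y(2) by (simp add: dist_norm)
    also have "x - (y + (1/2) *\<^sub>R (x - y)) = (1 - 1/2) *\<^sub>R (x - y)"
      by (simp only: scaleR_left_diff_distrib scaleR_one diff_diff_eq)
    finally show False using \<open>x \<noteq> y\<close> by simp
  qed
  then have "galerkin_proj A C = C"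
    using galerkin_proj_superset[OF C] by blast
  then show ?thesis
    using galerkin_proj_in_galerkin_space[OF C] by metis
qed

section \<open>The error constant of a Galerkin space\<close>

text \<open>The objective of the infimum in \<open>galerkin_kappa\<close>, for nonnegative weights: indices with \<open>p ! k = 0\<close>
contribute nothing, and the absolute values in the mass disappear.\<close>

definition dual_cost :: "(real^'d) list \<Rightarrow> real^'d \<Rightarrow> real list \<Rightarrow> real" where
  "dual_cost A c p = (\<Sum>k<length A. p ! k * norm (A ! k - (1 / (\<Sum>i<length A. p ! i)) *\<^sub>R c))"

lemma galerkin_kappa_alt:
  fixes A :: "(real^'d) list"
  shows "galerkin_kappa A = (SUP c\<in>{c. norm c = 1}. INF p\<in>dual_polyhedron A c. ereal (dual_cost A c p))"
  unfolding galerkin_kappa_def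
proof (intro SUP_cong INF_cong refl)
  fix c :: "real^'d" and p assume p: "p \<in> dual_polyhedron A c"
  then have len: "length p = length A" and nn: "\<And>i. i < length A \<Longrightarrow> 0 \<le> p ! i"
    by (auto simp: dual_polyhedron_def)
  have abs: "(\<Sum>i<length p. \<bar>p ! i\<bar>) = (\<Sum>i<length A. p ! i)"
    using nn by (simp add: len)
  have "(\<Sum>k\<in>positive_indices p. p ! k * norm (A ! k - (1 / (\<Sum>i<length p. \<bar>p ! i\<bar>)) *\<^sub>R c)) = dual_cost A c p"
    unfolding dual_cost_def abs
  proof (rule sum.mono_neutral_left)
    show "\<forall>k\<in>{..<length A} - positive_indices p. p ! k * norm (A ! k - (1 / sum ((!) p) {..<length A}) *\<^sub>R c) = 0"
      using nn by (auto simp: positive_indices_def len order.order_iff_strict)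
  qed (auto simp: positive_indices_def len)
  then show "ereal (\<Sum>k\<in>positive_indices p. p ! k * norm (A ! k - (1 / (\<Sum>i<length p. \<bar>p ! i\<bar>)) *\<^sub>R c))
      = ereal (dual_cost A c p)" by simp
qed

lemma galerkin_kappa_nonneg: "0 \<le> galerkin_kappa (A :: (real^'d) list)"
proof -
  obtain c :: "real^'d" where c: "norm c = 1"
    using vector_choose_size[of 1] by auto
  have "0 \<le> (INF p\<in>dual_polyhedron A c. ereal (dual_cost A c p))"
    by (rule INF_greatest) (auto simp: dual_cost_def dual_polyhedron_def intro!: sum_nonneg)
  also have "\<dots> \<le> galerkin_kappa A"
    unfolding galerkin_kappa_alt using c by (intro SUP_upper) simp
  finally show ?thesis .
qed

lemma galerkin_kappa_lessD:
  assumes "galerkin_kappa A < ereal t" "norm c = 1"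
  obtains p where "p \<in> dual_polyhedron A c" "dual_cost A c p < t"
proof -
  have "(INF p\<in>dual_polyhedron A c. ereal (dual_cost A c p)) \<le> galerkin_kappa A"
    unfolding galerkin_kappa_alt using assms(2) by (intro SUP_upper) simp
  also note assms(1)
  finally show ?thesis using that by (auto simp: INF_less_iff)
qed

lemma dual_polyhedron_mass:
  assumes A: "normalized_matrix A" and p: "p \<in> dual_polyhedron A c" and c: "norm c = 1"
  shows "1 \<le> (\<Sum>i<length A. p ! i)"
proof -
  have "1 = norm (\<Sum>i<length A. (p ! i) *\<^sub>R (A ! i))"
    using p c by (simp add: dual_polyhedron_def)
  also have "\<dots> \<le> (\<Sum>i<length A. norm ((p ! i) *\<^sub>R (A ! i)))"
    by (rule norm_sum)
  also have "\<dots> = (\<Sum>i<length A. p ! i)"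
    using A p by (intro sum.cong) (auto simp: dual_polyhedron_def normalized_matrix_def)
  finally show ?thesis .
qed

text \<open>Weak duality: \<open>c \<bullet> x\<close> is the combination of the \<open>a \<bullet> x\<close> with weights \<open>p\<close>, and each of these is at
most \<open>support_fun C a\<close>. Comparing \<open>a\<close> with \<open>c\<close> divided by the total mass bounds this by a multiple
of \<open>support_fun C c\<close> plus the distance of the two directions times \<open>set_norm C\<close>.\<close>

lemma support_fun_dual_bound:
  assumes A: "normalized_matrix A" and C: "C \<in> convex_bodies"
    and p: "p \<in> dual_polyhedron A c" and c: "norm c = 1" and x: "x \<in> galerkin_proj A C"
  shows "c \<bullet> x \<le> support_fun C c + dual_cost A c p * set_norm C"
proof -
  define s where "s = (\<Sum>i<length A. p ! i)"
  have s: "1 \<le> s" unfolding s_def by (rule dual_polyhedron_mass[OF A p c])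
  have nn: "\<And>i. i < length A \<Longrightarrow> 0 \<le> p ! i" and sum: "(\<Sum>i<length A. (p ! i) *\<^sub>R (A ! i)) = c"
    using p by (auto simp: dual_polyhedron_def)
  have supp: "support_fun C a \<le> support_fun C c / s + norm (a - (1 / s) *\<^sub>R c) * set_norm C" for a
  proof (rule support_fun_least[OF C])
    fix v assume v: "v \<in> C"
    have "a \<bullet> v = (c \<bullet> v) / s + (a - (1 / s) *\<^sub>R c) \<bullet> v"
      by (simp add: inner_diff_left)
    also have "(c \<bullet> v) / s \<le> support_fun C c / s"
      using s support_fun_upper[OF C v] by (intro divide_right_mono) auto
    also have "(a - (1 / s) *\<^sub>R c) \<bullet> v \<le> norm (a - (1 / s) *\<^sub>R c) * norm v"
      by (rule norm_cauchy_schwarz)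
    also have "\<dots> \<le> norm (a - (1 / s) *\<^sub>R c) * set_norm C"
      by (intro mult_left_mono norm_le_set_norm[OF C v]) simp
    finally show "a \<bullet> v \<le> support_fun C c / s + norm (a - (1 / s) *\<^sub>R c) * set_norm C"
      by simp
  qed
  have "c \<bullet> x = (\<Sum>i<length A. p ! i * ((A ! i) \<bullet> x))"
    by (simp flip: sum add: inner_sum_left)
  also have "\<dots> \<le> (\<Sum>i<length A. p ! i * (support_fun C c / s + norm (A ! i - (1 / s) *\<^sub>R c) * set_norm C))"
    using x by (intro sum_mono mult_left_mono nn order_trans[OF _ supp]) (auto simp: galerkin_proj_iff)
  also have "\<dots> = s * (support_fun C c / s) + dual_cost A c p * set_norm C"
    by (simp only: dual_cost_def s_def sum_distrib_right distrib_left sum.distrib mult.assoc)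
  also have "s * (support_fun C c / s) = support_fun C c"
    using s by simp
  finally show ?thesis .
qed

text \<open>For \<open>x\<close> in the projection but not in \<open>C\<close>, the unit vector \<open>c\<close> from the nearest point \<open>y\<close> to \<open>x\<close> is
an outer normal of \<open>C\<close> at \<open>y\<close>. Hence the distance is \<open>c \<bullet> x - support_fun C c\<close>, to which the dual
bound applies. Dual vectors are available with cost below any \<open>t > K\<close>, and the
bound follows as \<open>t\<close> decreases to \<open>K\<close>.\<close>

lemma galerkin_proj_error:
  assumes A: "normalized_matrix A" and C: "C \<in> convex_bodies" and K: "galerkin_kappa A \<le> ereal K"
  shows "hausdorff_within (K * set_norm C) C (galerkin_proj A C)"
proof -
  have K0: "0 \<le> K"
    using galerkin_kappa_nonneg[of A] K by (metis ereal_less_eq(5) order_trans)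
  have "dist (closest_point C x) x \<le> K * set_norm C" if x: "x \<in> galerkin_proj A C" for x
  proof (cases "x \<in> C")
    case True
    then show ?thesis using K0 set_norm_nonneg[OF C] by (simp add: closest_point_self)
  next
    case False
    define y where "y = closest_point C x"
    have y: "y \<in> C" unfolding y_def by (intro closest_point_in_set convex_bodiesD C)
    define c where "c = (1 / norm (x - y)) *\<^sub>R (x - y)"
    have "x \<noteq> y" using False y by blast
    then have c: "norm c = 1" by (simp add: c_def)
    have "support_fun C c \<le> c \<bullet> y"
    proof (rule support_fun_least[OF C])
      fix v assume "v \<in> C"
      then have "(x - y) \<bullet> (v - y) \<le> 0"
        unfolding y_def by (intro closest_point_dot convex_bodiesD C)
      then show "c \<bullet> v \<le> c \<bullet> y"
        by (simp add: c_def inner_diff_right divide_right_mono)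
    qed
    moreover have "c \<bullet> x - c \<bullet> y = norm (x - y)"
    proof -
      have "c \<bullet> x - c \<bullet> y = (1 / norm (x - y)) * ((x - y) \<bullet> (x - y))"
        by (simp add: c_def inner_diff_right[symmetric] diff_divide_distrib[symmetric])
      then show ?thesis
        by (simp add: power2_norm_eq_inner[symmetric] power2_eq_square)
    qed
    ultimately have gap: "dist y x \<le> c \<bullet> x - support_fun C c"
      by (simp add: dist_norm norm_minus_commute)
    have "dist y x \<le> t * set_norm C" if "K < t" for t
    proof -
      have "galerkin_kappa A < ereal t"
        using that by (intro le_less_trans[OF K]) simp
      then obtain p where p: "p \<in> dual_polyhedron A c" "dual_cost A c p < t"
        using c by (rule galerkin_kappa_lessD)
      have "dual_cost A c p * set_norm C \<le> t * set_norm C"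
        using p(2) set_norm_nonneg[OF C] by (intro mult_right_mono) auto
      then show ?thesis
        using gap support_fun_dual_bound[OF A C p(1) c x] by simp
    qed
    then have "\<forall>\<^sub>F t in at_right K. dist y x \<le> t * set_norm C"
      by (auto simp: eventually_at_filter)
    moreover have "((\<lambda>t. t * set_norm C) \<longlongrightarrow> K * set_norm C) (at_right K)"
      by (intro tendsto_intros)
    ultimately show ?thesis
      unfolding y_def by (intro tendsto_lowerbound[of _ _ "at_right K"]) auto
  qed
  moreover have "closest_point C x \<in> C" for x
    by (intro closest_point_in_set convex_bodiesD C)
  moreover have "\<exists>y\<in>galerkin_proj A C. dist x y \<le> K * set_norm C" if "x \<in> C" for x
    using that galerkin_proj_superset[OF C] K0 set_norm_nonneg[OF C] by (intro bexI[of _ x]) auto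
  ultimately show ?thesis
    unfolding hausdorff_within_def by blast
qed

lemma sum_rows:
  assumes "normalized_matrix A"
  shows "(\<Sum>i<length A. f (A ! i)) = sum f (set A)"
  using assms by (intro sum.reindex_bij_betw bij_betw_nth) (auto simp: normalized_matrix_def)

text \<open>One half of linear programming duality: the least total mass of a representation of \<open>c\<close> is at
most the maximum of \<open>c \<bullet> x\<close> over \<open>{x. a \<bullet> x \<le> 1 for all rows a}\<close>. If \<open>c / R\<close> were
not in the convex hull of the rows and \<open>0\<close>, a separating functional, scaled to be at most \<open>1\<close> on
the rows, would be a point of that polyhedron of norm larger than \<open>R\<close>.\<close>

lemma dual_polyhedron_of_bounded_polyhedron:
  fixes A :: "(real^'d) list"
  assumes A: "normalized_matrix A" and c: "norm c = 1" and R: "0 < R"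
    and bounded: "\<And>x. (\<And>a. a \<in> set A \<Longrightarrow> a \<bullet> x \<le> 1) \<Longrightarrow> norm x \<le> R"
  obtains p where "p \<in> dual_polyhedron A c" "(\<Sum>i<length A. p ! i) \<le> R"
proof -
  let ?H = "convex hull (insert 0 (set A))"
  have "(1 / R) *\<^sub>R c \<in> ?H"
  proof (rule ccontr)
    assume "(1 / R) *\<^sub>R c \<notin> ?H"
    moreover have "closed ?H"
      by (intro compact_imp_closed compact_convex_hull finite_imp_compact) simp
    ultimately obtain v b where sep: "v \<bullet> ((1 / R) *\<^sub>R c) < b" "\<And>x. x \<in> ?H \<Longrightarrow> b < v \<bullet> x"
      using separating_hyperplane_closed_point[of ?H "(1 / R) *\<^sub>R c"] by auto
    have "b < 0"
      using sep(2)[of 0] by (simp add: hull_inc)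
    \<comment> \<open>As \<open>b < 0\<close>, this scaling reverses the inequalities of the separation and normalizes the bound to \<open>1\<close>.\<close>
    define x where "x = (1 / b) *\<^sub>R v"
    have "a \<bullet> x \<le> 1" if "a \<in> set A" for a
      using sep(2)[of a] \<open>b < 0\<close> that by (simp add: x_def hull_inc inner_commute divide_le_eq)
    then have "norm x \<le> R" by (rule bounded)
    moreover have "R < x \<bullet> c"
      using sep(1) \<open>b < 0\<close> R by (simp add: x_def field_simps)
    moreover have "x \<bullet> c \<le> norm x"
      using norm_cauchy_schwarz[of x c] c by simp
    ultimately show False by simp
  qed
  then obtain u where u: "\<And>x. x \<in> insert 0 (set A) \<Longrightarrow> 0 \<le> u x" "sum u (insert 0 (set A)) = 1"
      "(\<Sum>x\<in>insert 0 (set A). u x *\<^sub>R x) = (1 / R) *\<^sub>R c"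
    by (auto simp: convex_hull_finite)
  have "0 \<notin> set A" using A by (auto simp: normalized_matrix_def)
  define p where "p = map (\<lambda>a. R * u a) A"
  show ?thesis
  proof
    have "(\<Sum>i<length A. (p ! i) *\<^sub>R (A ! i)) = (\<Sum>i<length A. (R * u (A ! i)) *\<^sub>R (A ! i))"
      by (simp add: p_def)
    also have "\<dots> = (\<Sum>a\<in>set A. (R * u a) *\<^sub>R a)"
      by (rule sum_rows[OF A])
    also have "\<dots> = R *\<^sub>R (\<Sum>a\<in>insert 0 (set A). u a *\<^sub>R a)"
      using \<open>0 \<notin> set A\<close> by (simp add: scaleR_sum_right)
    also have "\<dots> = c" using u(3) R by simp
    finally show "p \<in> dual_polyhedron A c"
      using u(1) R by (simp add: dual_polyhedron_def p_def)
    have "(\<Sum>i<length A. p ! i) = (\<Sum>i<length A. R * u (A ! i))"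
      by (simp add: p_def)
    also have "\<dots> = R * sum u (set A)"
      by (simp only: sum_distrib_left sum_rows[OF A, of "\<lambda>a. R * u a"])
    also have "\<dots> \<le> R * 1"
      using u(1)[of 0] u(2) \<open>0 \<notin> set A\<close> R by (intro mult_left_mono) auto
    finally show "(\<Sum>i<length A. p ! i) \<le> R" by simp
  qed
qed

text \<open>With unit rows and unit \<open>c\<close>, the weighted mean of the squared distances \<open>(norm (a - c / s))\<^sup>2\<close> is
\<open>1 - 1 / s\<^sup>2\<close>, where \<open>s\<close> is the total mass; the bound is then Cauchy-Schwarz.\<close>

lemma dual_cost_le_mass:
  assumes A: "normalized_matrix A" and p: "p \<in> dual_polyhedron A c" and c: "norm c = 1"
  shows "dual_cost A c p \<le> sqrt ((\<Sum>i<length A. p ! i)\<^sup>2 - 1)"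
proof -
  define s where "s = (\<Sum>i<length A. p ! i)"
  have s: "1 \<le> s" unfolding s_def by (rule dual_polyhedron_mass[OF A p c])
  have nn: "\<And>i. i < length A \<Longrightarrow> 0 \<le> p ! i" and sum: "(\<Sum>i<length A. (p ! i) *\<^sub>R (A ! i)) = c"
    using p by (auto simp: dual_polyhedron_def)
  define w where "w = (\<lambda>i. norm (A ! i - (1 / s) *\<^sub>R c))"
  have w2: "(w i)\<^sup>2 = 1 - 2 / s * ((A ! i) \<bullet> c) + 1 / s\<^sup>2" if "i < length A" for i
  proof -
    have "(A ! i) \<bullet> (A ! i) = 1" "c \<bullet> c = 1"
      using A that c by (auto simp: normalized_matrix_def power2_norm_eq_inner[symmetric])
    then show ?thesis
      unfolding w_def power2_norm_eq_inner
      by (simp add: inner_diff_left inner_diff_right inner_commute power2_eq_square)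
  qed
  have "(dual_cost A c p)\<^sup>2 = (\<Sum>i<length A. sqrt (p ! i) * (sqrt (p ! i) * w i))\<^sup>2"
    unfolding dual_cost_def s_def[symmetric] w_def using nn by (simp add: mult.assoc[symmetric])
  also have "\<dots> \<le> (\<Sum>i<length A. (sqrt (p ! i))\<^sup>2) * (\<Sum>i<length A. (sqrt (p ! i) * w i)\<^sup>2)"
    by (rule Cauchy_Schwarz_ineq_sum)
  also have "\<dots> = s * (\<Sum>i<length A. p ! i * (w i)\<^sup>2)"
    using nn by (simp add: s_def power_mult_distrib)
  also have "(\<Sum>i<length A. p ! i * (w i)\<^sup>2) = (\<Sum>i<length A. p ! i - 2 / s * (p ! i * ((A ! i) \<bullet> c)) + p ! i * (1 / s\<^sup>2))"
    by (intro sum.cong refl) (simp add: w2 algebra_simps)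
  also have "\<dots> = s - 2 / s * ((\<Sum>i<length A. (p ! i) *\<^sub>R (A ! i)) \<bullet> c) + s * (1 / s\<^sup>2)"
    by (simp only: sum.distrib sum_subtractf sum_distrib_left[symmetric] sum_distrib_right[symmetric]
        s_def inner_sum_left inner_scaleR_left)
  also have "\<dots> = s - 1 / s"
    using s c by (simp add: sum power2_eq_square dot_square_norm)
  also have "s * (s - 1 / s) = s\<^sup>2 - 1"
    using s by (simp add: power2_eq_square algebra_simps)
  finally show ?thesis
    unfolding s_def by (rule real_le_rsqrt)
qed

lemma cball_convex_body: "0 \<le> r \<Longrightarrow> cball x r \<in> convex_bodies"
  by (simp add: convex_bodies_def)

text \<open>Each row is itself a point of the unit ball, so the right-hand sides of a polyhedron within
\<open>\<beta>\<close> of the ball are at least \<open>1 - \<beta>\<close>. That polyhedron thus contains the unit polyhedron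
\<open>{x. a \<bullet> x \<le> 1 for all rows a}\<close> scaled by \<open>1 - \<beta>\<close>, and is contained in the ball of radius \<open>1 + \<beta>\<close>.\<close>

lemma galerkin_kappa_le_of_unit_ball:
  fixes A :: "(real^'d) list"
  assumes A: "normalized_matrix A" and D: "D \<in> galerkin_space A"
    and near: "hausdorff_within \<beta> (cball 0 1) D" and \<beta>: "0 \<le> \<beta>" "\<beta> < 1"
  shows "galerkin_kappa A \<le> ereal (sqrt (((1 + \<beta>) / (1 - \<beta>))\<^sup>2 - 1))"
proof -
  define R where "R = (1 + \<beta>) / (1 - \<beta>)"
  have R: "0 < R" using \<beta> by (simp add: R_def)
  obtain b where b: "D = polyhedron_of A b"
    using D by (auto simp: galerkin_space_def)
  have b_ge: "1 - \<beta> \<le> b ! i" if i: "i < length A" for i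
  proof -
    have unit: "norm (A ! i) = 1" using A i by (simp add: normalized_matrix_def)
    then obtain d where d: "d \<in> D" "norm (A ! i - d) \<le> \<beta>"
      using near by (force simp: hausdorff_within_def dist_norm)
    have "(A ! i) \<bullet> (A ! i - d) \<le> norm (A ! i) * norm (A ! i - d)"
      by (rule norm_cauchy_schwarz)
    then have "1 - (A ! i) \<bullet> d \<le> \<beta>"
      using d unit by (simp add: inner_diff_right dot_square_norm)
    moreover have "(A ! i) \<bullet> d \<le> b ! i"
      using d(1) i by (simp add: b polyhedron_of_def)
    ultimately show ?thesis by simp
  qed
  have bounded: "norm x \<le> R" if x: "\<And>a. a \<in> set A \<Longrightarrow> a \<bullet> x \<le> 1" for x
  proof -
    have "(1 - \<beta>) *\<^sub>R x \<in> D"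
      unfolding b polyhedron_of_def
    proof (intro CollectI allI impI)
      fix i assume i: "i < length A"
      have "(1 - \<beta>) * ((A ! i) \<bullet> x) \<le> (1 - \<beta>) * 1"
        using x i \<beta> by (intro mult_left_mono) auto
      then show "(A ! i) \<bullet> ((1 - \<beta>) *\<^sub>R x) \<le> b ! i"
        using b_ge[OF i] by simp
    qed
    then obtain y where "norm y \<le> 1" "dist y ((1 - \<beta>) *\<^sub>R x) \<le> \<beta>"
      using near by (auto simp: hausdorff_within_def)
    then have "norm ((1 - \<beta>) *\<^sub>R x) \<le> 1 + \<beta>"
      using norm_triangle_ineq2[of "(1 - \<beta>) *\<^sub>R x" y] by (simp add: dist_norm norm_minus_commute)
    then show ?thesis using \<beta> by (simp add: R_def pos_le_divide_eq mult.commute)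
  qed
  show ?thesis
    unfolding galerkin_kappa_alt R_def[symmetric]
  proof (rule SUP_least)
    fix c :: "real^'d" assume "c \<in> {c. norm c = 1}"
    then have c: "norm c = 1" by simp
    obtain p where p: "p \<in> dual_polyhedron A c" "(\<Sum>i<length A. p ! i) \<le> R"
      using dual_polyhedron_of_bounded_polyhedron[OF A c R bounded] by blast
    have "dual_cost A c p \<le> sqrt ((\<Sum>i<length A. p ! i)\<^sup>2 - 1)"
      by (rule dual_cost_le_mass[OF A p(1) c])
    also have "\<dots> \<le> sqrt (R\<^sup>2 - 1)"
      using p(2) dual_polyhedron_mass[OF A p(1) c] by (simp add: power_mono)
    finally show "(INF p\<in>dual_polyhedron A c. ereal (dual_cost A c p)) \<le> ereal (sqrt (R\<^sup>2 - 1))"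
      using p(1) by (meson INF_lower2 ereal_less_eq(3))
  qed
qed

lemma nested_galerkin_kappa_tendsto_0:
  fixes A :: "nat \<Rightarrow> (real^'d) list"
  assumes "nested_galerkin A"
  shows "(\<lambda>k. galerkin_kappa (A k)) \<longlonglongrightarrow> 0"
proof -
  obtain \<alpha> :: "nat \<Rightarrow> real" where \<alpha>: "\<And>k. 0 \<le> \<alpha> k" "\<alpha> \<longlonglongrightarrow> 0"
    and approx: "\<And>k C. C \<in> convex_bodies \<Longrightarrow> (INF D\<in>galerkin_space (A k). dist_H C D) \<le> ereal (\<alpha> k * set_norm C)"
    using assms unfolding nested_galerkin_def by blast
  have norm: "normalized_matrix (A k)" for k
    using assms by (simp add: nested_galerkin_def)
  \<comment> \<open>The infimum need not be attained; the summand \<open>1 / Suc k\<close> leaves room to choose a polyhedron.\<close>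
  define \<beta> where "\<beta> = (\<lambda>k. \<alpha> k + 1 / real (Suc k))"
  have "\<beta> \<longlonglongrightarrow> 0 + 0"
    unfolding \<beta>_def by (intro tendsto_add \<alpha> LIMSEQ_Suc[OF lim_1_over_n])
  then have lim: "\<beta> \<longlonglongrightarrow> 0" by simp
  have "set_norm (cball (0::real^'d) 1) \<le> 1"
    unfolding set_norm_def by (intro cSUP_least) auto
  then have "\<alpha> k * set_norm (cball (0::real^'d) 1) \<le> \<alpha> k * 1" for k
    by (intro mult_left_mono \<alpha>)
  also have "\<alpha> k * 1 < \<beta> k" for k by (simp add: \<beta>_def)
  finally have "(INF D\<in>galerkin_space (A k). dist_H (cball 0 1) D) < ereal (\<beta> k)" for k
    using approx[OF cball_convex_body[of 1 0], of k] by (simp add: le_less_trans)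
  then have near: "\<exists>D\<in>galerkin_space (A k). hausdorff_within (\<beta> k) (cball 0 1) D" for k
    unfolding INF_less_iff by (blast dest: dist_H_lessD)
  have "\<forall>\<^sub>F k in sequentially. \<beta> k < 1"
    using lim by (rule order_tendstoD) simp
  then have upper: "\<forall>\<^sub>F k in sequentially. galerkin_kappa (A k) \<le> ereal (sqrt (((1 + \<beta> k) / (1 - \<beta> k))\<^sup>2 - 1))"
  proof eventually_elim
    case (elim k)
    have "0 \<le> \<beta> k" by (simp add: \<beta>_def \<alpha>(1))
    then show ?case
      using near[of k] galerkin_kappa_le_of_unit_ball[OF norm _ _ _ elim] by blast
  qed
  have "(\<lambda>k. sqrt (((1 + \<beta> k) / (1 - \<beta> k))\<^sup>2 - 1)) \<longlonglongrightarrow> sqrt (((1 + 0) / (1 - 0))\<^sup>2 - 1)"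
    by (intro tendsto_intros lim) simp
  then have majorant: "(\<lambda>k. ereal (sqrt (((1 + \<beta> k) / (1 - \<beta> k))\<^sup>2 - 1))) \<longlonglongrightarrow> 0"
    by (simp add: zero_ereal_def)
  show ?thesis
  proof (rule tendsto_sandwich)
    show "\<forall>\<^sub>F k in sequentially. 0 \<le> galerkin_kappa (A k)"
      by (simp add: galerkin_kappa_nonneg)
  qed (fact upper tendsto_const majorant)+
qed

section \<open>Minimizers on compact families of convex bodies\<close>

lemma continuous_H_tendsto:
  assumes F: "continuous_H F" and S: "\<And>j. S j \<in> convex_bodies" and C: "C \<in> convex_bodies"
    and lim: "(\<lambda>j. dist_H (S j) C) \<longlonglongrightarrow> 0"
  shows "(\<lambda>j. F (S j)) \<longlonglongrightarrow> F C"
proof (rule tendstoI)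
  fix e :: real assume "e > 0"
  then obtain d where d: "d > 0" "\<And>D. D \<in> convex_bodies \<Longrightarrow> dist_H D C < ereal d \<Longrightarrow> \<bar>F D - F C\<bar> < e"
    using F C unfolding continuous_H_def by blast
  have "\<forall>\<^sub>F j in sequentially. dist_H (S j) C < ereal d"
    using order_tendstoD(2)[OF lim, of "ereal d"] d(1) by simp
  then show "\<forall>\<^sub>F j in sequentially. dist (F (S j)) (F C) < e"
    by (rule eventually_mono) (use d(2) S in \<open>simp add: dist_real_def\<close>)
qed

lemma continuous_H_imp_lsc_H:
  fixes F :: "(real^'d) set \<Rightarrow> real"
  assumes "continuous_H F"
  shows "lsc_H F"
  unfolding lsc_H_def
proof (intro ballI allI impI)
  fix C and S :: "nat \<Rightarrow> (real^'d) set" assume "C \<in> convex_bodies" "\<forall>j. S j \<in> convex_bodies" "(\<lambda>j. dist_H (S j) C) \<longlonglongrightarrow> 0"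
  then have "(\<lambda>j. ereal (F (S j))) \<longlonglongrightarrow> ereal (F C)"
    using continuous_H_tendsto[OF assms] by simp
  then have "liminf (\<lambda>j. ereal (F (S j))) = ereal (F C)"
    by (rule lim_imp_Liminf[OF sequentially_bot])
  then show "ereal (F C) \<le> liminf (\<lambda>j. ereal (F (S j)))"
    by simp
qed

lemma argmin_set_iff:
  fixes f :: "'a \<Rightarrow> real"
  shows "x \<in> argmin_set f S \<longleftrightarrow> x \<in> S \<and> (\<forall>y\<in>S. f x \<le> f y)"
  by (auto simp: argmin_set_def is_arg_min_def not_less)

text \<open>The direct method. The infimum is taken in the extended reals, so that boundedness from
below is a consequence of the existence of the minimizer.\<close>

lemma lsc_H_attains_min:
  assumes F: "lsc_H F" and M: "M \<noteq> {}" "M \<subseteq> convex_bodies"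
    and compact: "\<And>S. (\<And>j. S j \<in> M) \<Longrightarrow>
      \<exists>C\<in>M. \<exists>r. strict_mono (r :: nat \<Rightarrow> nat) \<and> (\<lambda>j. dist_H (S (r j)) C) \<longlonglongrightarrow> 0"
  shows "argmin_set F M \<noteq> {}"
proof -
  let ?V = "(\<lambda>C. ereal (F C)) ` M"
  obtain f :: "nat \<Rightarrow> ereal" where f: "decseq f" "range f \<subseteq> ?V" "Inf ?V = (INF i. f i)"
    using Inf_countable_INF[of ?V] M(1) by auto
  have "\<forall>j. \<exists>C\<in>M. f j = ereal (F C)" using f(2) by blast
  then obtain S where S: "\<And>j. S j \<in> M" "\<And>j. f j = ereal (F (S j))"
    by metis
  obtain C r where C: "C \<in> M" and r: "strict_mono (r :: nat \<Rightarrow> nat)"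
    and lim: "(\<lambda>j. dist_H (S (r j)) C) \<longlonglongrightarrow> 0"
    using compact[of S] S(1) by blast
  have "f \<longlonglongrightarrow> Inf ?V" using LIMSEQ_INF[OF f(1)] f(3) by simp
  then have "(\<lambda>j. f (r j)) \<longlonglongrightarrow> Inf ?V"
    using LIMSEQ_subseq_LIMSEQ[OF _ r] by (fastforce simp: o_def)
  then have "liminf (\<lambda>j. ereal (F (S (r j)))) = Inf ?V"
    using S(2) lim_imp_Liminf[OF sequentially_bot] by simp
  moreover have "ereal (F C) \<le> liminf (\<lambda>j. ereal (F (S (r j))))"
    using F C M(2) S(1) lim unfolding lsc_H_def by (metis subsetD)
  ultimately have "ereal (F C) \<le> ereal (F D)" if "D \<in> M" for D
    using that by (metis INF_lower order_trans)
  then show ?thesis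
    using C argmin_set_iff[of C F M] by auto
qed

lemma lipschitz_H_component:
  assumes "lipschitz_H L \<Psi>" "C \<in> convex_bodies" "D \<in> convex_bodies" "hausdorff_within e C D"
  shows "\<bar>\<Psi> C $ i - \<Psi> D $ i\<bar> \<le> L * e"
proof -
  have "\<bar>\<Psi> C $ i - \<Psi> D $ i\<bar> \<le> infnorm (\<Psi> C - \<Psi> D)"
    using component_le_infnorm_cart[of "\<Psi> C - \<Psi> D" i] by simp
  moreover have "ereal (infnorm (\<Psi> C - \<Psi> D)) \<le> ereal L * dist_H C D"
    using assms(1-3) by (simp add: lipschitz_H_def)
  moreover have "ereal L * dist_H C D \<le> ereal L * ereal e"
    using assms(1) dist_H_le[OF assms(4)] by (intro ereal_mult_left_mono) (simp_all add: lipschitz_H_def)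
  ultimately have "ereal \<bar>\<Psi> C $ i - \<Psi> D $ i\<bar> \<le> ereal (L * e)"
    by (metis ereal_less_eq(3) order_trans times_ereal.simps(1))
  then show ?thesis by simp
qed

lemma lipschitz_H_limit_le:
  assumes \<Psi>: "lipschitz_H L \<Psi>" and S: "\<And>j. S j \<in> convex_bodies" and C: "C \<in> convex_bodies"
    and lim: "(\<lambda>j. dist_H (S j) C) \<longlonglongrightarrow> 0"
    and le: "\<And>j. \<Psi> (S j) $ i \<le> c j" and c: "c \<longlonglongrightarrow> c0"
  shows "\<Psi> C $ i \<le> c0"
proof -
  have L: "0 \<le> L" using \<Psi> by (simp add: lipschitz_H_def)
  have "(\<lambda>j. \<Psi> (S j) $ i) \<longlonglongrightarrow> \<Psi> C $ i"
  proof (rule tendstoI)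
    fix e :: real assume e: "e > 0"
    then have "0 < e / (L + 1)" using L by simp
    from hausdorff_limitD[OF S lim this]
    show "\<forall>\<^sub>F j in sequentially. dist (\<Psi> (S j) $ i) (\<Psi> C $ i) < e"
    proof eventually_elim
      case (elim j)
      have "\<bar>\<Psi> (S j) $ i - \<Psi> C $ i\<bar> \<le> L * (e / (L + 1))"
        by (rule lipschitz_H_component[OF \<Psi> S C elim])
      also have "\<dots> < e" using L e by (simp add: field_simps)
      finally show ?case by (simp add: dist_real_def)
    qed
  qed
  then show ?thesis using c le by (meson LIMSEQ_le)
qed

lemma hausdorff_limit_const: "C \<noteq> {} \<Longrightarrow> ((\<lambda>_. dist_H C C) \<longlongrightarrow> 0) F"
  by (subst dist_H_tendsto_0_iff)
     (auto simp: hausdorff_within_def intro!: always_eventually intro: rev_bexI)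

lemma convex_body_family_compact:
  assumes M: "M \<subseteq> convex_bodies" "\<And>C. C \<in> M \<Longrightarrow> C \<subseteq> B" and B: "bounded B"
    and closed: "\<And>S C. (\<And>j. S j \<in> M) \<Longrightarrow> C \<in> convex_bodies \<Longrightarrow> (\<lambda>j. dist_H (S j) C) \<longlonglongrightarrow> 0 \<Longrightarrow> C \<in> M"
    and S: "\<And>j. S j \<in> M"
  shows "\<exists>C\<in>M. \<exists>r. strict_mono (r :: nat \<Rightarrow> nat) \<and> (\<lambda>j. dist_H (S (r j)) C) \<longlonglongrightarrow> 0"
proof -
  obtain R where "B \<subseteq> cball 0 R"
    using B by (auto simp: bounded_iff subset_iff)
  then obtain C r where C: "C \<in> convex_bodies" "strict_mono (r :: nat \<Rightarrow> nat)" "(\<lambda>j. dist_H (S (r j)) C) \<longlonglongrightarrow> 0"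
    using blaschke_selection[of S R] M S by (metis order_trans subsetD)
  then show ?thesis using closed[of "\<lambda>j. S (r j)"] S by blast
qed

lemma argmin_feasible_set_nonempty:
  fixes \<Phi> :: "(real^'d) set \<Rightarrow> real"
  assumes \<Phi>: "continuous_H \<Phi>" and \<Psi>: "lipschitz_H L \<Psi>"
    and Clo: "Clo \<in> convex_bodies" and Chi: "Chi \<in> convex_bodies"
    and ne: "feasible_set \<Psi> Clo Chi \<noteq> {}"
  shows "argmin_set \<Phi> (feasible_set \<Psi> Clo Chi) \<noteq> {}"
proof (rule lsc_H_attains_min[OF continuous_H_imp_lsc_H[OF \<Phi>] ne])
  let ?M = "feasible_set \<Psi> Clo Chi"
  show bodies: "?M \<subseteq> convex_bodies" by (auto simp: feasible_set_def)
  have closed: "C \<in> ?M"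
    if S: "\<And>j. S j \<in> ?M" and C: "C \<in> convex_bodies" and lim: "(\<lambda>j. dist_H (S j) C) \<longlonglongrightarrow> 0"
    for S :: "nat \<Rightarrow> (real^'d) set" and C
  proof -
    have Sb: "S j \<in> convex_bodies" for j using S bodies by blast
    have Slo: "Clo \<subseteq> S j" and Shi: "S j \<subseteq> Chi" for j using S by (auto simp: feasible_set_def)
    have "\<Psi> C $ i \<le> 0" for i
      using S by (intro lipschitz_H_limit_le[OF \<Psi> Sb C lim _ tendsto_const])
         (auto simp: feasible_set_def less_eq_vec_def)
    moreover have "Clo \<subseteq> C"
      by (rule hausdorff_limit_mono[OF Clo hausdorff_limit_const Sb lim convex_bodiesD(4)[OF C] Slo])
         (rule convex_bodiesD(1)[OF Clo])
    moreover have "C \<subseteq> Chi"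
      by (rule hausdorff_limit_mono[OF Sb lim Chi hausdorff_limit_const convex_bodiesD(4)[OF Chi] Shi])
         (rule convex_bodiesD(1)[OF Chi])
    ultimately show ?thesis using C by (simp add: feasible_set_def less_eq_vec_def)
  qed
  show "\<exists>C\<in>?M. \<exists>r. strict_mono r \<and> (\<lambda>j. dist_H (S (r j)) C) \<longlonglongrightarrow> 0"
    if "\<And>j. S j \<in> ?M" for S :: "nat \<Rightarrow> (real^'d) set"
  proof (rule convex_body_family_compact[OF bodies _ convex_bodiesD(5)[OF Chi]])
    show "C \<subseteq> Chi" if "C \<in> ?M" for C
      using that by (simp add: feasible_set_def)
  qed (fact closed that)+
qed

section \<open>The discretized problems\<close>

text \<open>Polyhedra of a Galerkin space may be unbounded, but with a finite error constant projections
of bodies are not, because they stay close to the body. The discrete feasible families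
inherit boundedness from the upper constraint.\<close>

lemma galerkin_proj_convex_body:
  assumes "normalized_matrix A" "C \<in> convex_bodies" "galerkin_kappa A \<le> ereal K"
  shows "galerkin_proj A C \<in> convex_bodies"
proof (rule galerkin_space_bounded_imp_convex_body[OF galerkin_proj_in_galerkin_space[OF assms(2)]])
  have "norm x \<le> set_norm C + K * set_norm C" if x: "x \<in> galerkin_proj A C" for x
  proof -
    obtain y where y: "y \<in> C" "dist y x \<le> K * set_norm C"
      using galerkin_proj_error[OF assms] x unfolding hausdorff_within_def by blast
    then show ?thesis
      using norm_le_set_norm[OF assms(2) y(1)] norm_triangle_ineq2[of x y]
      by (simp add: dist_norm norm_minus_commute)
  qed
  then show "bounded (galerkin_proj A C)" by (auto simp: bounded_iff)
qed

lemma galerkin_feasible_set_convex_bodies: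
  assumes "normalized_matrix A" "Chi \<in> convex_bodies" "galerkin_kappa A \<le> ereal K"
  shows "galerkin_feasible_set A \<Psi> Clo Chi \<subseteq> convex_bodies"
  using convex_bodiesD(5)[OF galerkin_proj_convex_body[OF assms]]
  by (auto simp: galerkin_feasible_set_def intro: galerkin_space_bounded_imp_convex_body bounded_subset)

text \<open>The Lipschitz bound gives \<open>\<Psi> (P D) \<le> \<Psi> D + L * K * \<parallel>D\<parallel>\<close>, which the relaxation of the constraint
compensates since \<open>\<parallel>D\<parallel> \<le> \<parallel>Chi\<parallel>\<close>; the set constraints hold by monotonicity of the projection.\<close>

lemma galerkin_proj_feasible:
  assumes A: "normalized_matrix A" and K: "galerkin_kappa A \<le> ereal K"
    and \<Psi>: "lipschitz_H L \<Psi>"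
    and Clo: "Clo \<in> convex_bodies" and Chi: "Chi \<in> convex_bodies"
    and \<Psi>': "\<And>C. C \<in> convex_bodies \<Longrightarrow> \<Psi>' C = \<Psi> C - (L * K * set_norm Chi) *\<^sub>R 1"
    and D: "D \<in> feasible_set \<Psi> Clo Chi"
  shows "galerkin_proj A D \<in> galerkin_feasible_set A \<Psi>' Clo Chi"
proof -
  have Db: "D \<in> convex_bodies" "Clo \<subseteq> D" "D \<subseteq> Chi" and D0: "\<And>i. \<Psi> D $ i \<le> 0"
    using D by (auto simp: feasible_set_def less_eq_vec_def)
  have K0: "0 \<le> K"
    using galerkin_kappa_nonneg[of A] K by (metis ereal_less_eq(5) order_trans)
  have L: "0 \<le> L" using \<Psi> by (simp add: lipschitz_H_def)
  have P: "galerkin_proj A D \<in> convex_bodies"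
    by (rule galerkin_proj_convex_body[OF A Db(1) K])
  have "\<Psi>' (galerkin_proj A D) $ i \<le> 0" for i
  proof -
    have "\<bar>\<Psi> D $ i - \<Psi> (galerkin_proj A D) $ i\<bar> \<le> L * (K * set_norm D)"
      by (rule lipschitz_H_component[OF \<Psi> Db(1) P galerkin_proj_error[OF A Db(1) K]])
    also have "\<dots> \<le> L * (K * set_norm Chi)"
      using set_norm_mono[OF Db(1) Chi Db(3)] K0 L by (intro mult_left_mono)
    finally show ?thesis
      using D0[of i] by (simp add: \<Psi>'[OF P] mult.assoc)
  qed
  then show ?thesis
    using galerkin_proj_in_galerkin_space[OF Db(1)] galerkin_proj_mono[OF Clo Db(1,2)]
      galerkin_proj_mono[OF Db(1) Chi Db(3)]
    by (simp add: galerkin_feasible_set_def less_eq_vec_def)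
qed

lemma argmin_galerkin_feasible_set_nonempty:
  fixes A :: "(real^'d) list"
  assumes A: "normalized_matrix A" and K: "galerkin_kappa A \<le> ereal K"
    and F: "lsc_H F" and \<Psi>: "lipschitz_H L \<Psi>"
    and Clo: "Clo \<in> convex_bodies" and Chi: "Chi \<in> convex_bodies"
    and \<Psi>': "\<And>C. C \<in> convex_bodies \<Longrightarrow> \<Psi>' C = \<Psi> C - \<theta> *\<^sub>R 1"
    and ne: "galerkin_feasible_set A \<Psi>' Clo Chi \<noteq> {}"
  shows "argmin_set F (galerkin_feasible_set A \<Psi>' Clo Chi) \<noteq> {}"
proof (rule lsc_H_attains_min[OF F ne])
  let ?M = "galerkin_feasible_set A \<Psi>' Clo Chi"
  show bodies: "?M \<subseteq> convex_bodies"
    by (rule galerkin_feasible_set_convex_bodies[OF A Chi K])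
  note P = galerkin_proj_convex_body[OF A _ K]
  have closed: "C \<in> ?M"
    if S: "\<And>j. S j \<in> ?M" and C: "C \<in> convex_bodies" and lim: "(\<lambda>j. dist_H (S j) C) \<longlonglongrightarrow> 0"
    for S :: "nat \<Rightarrow> (real^'d) set" and C
  proof -
    have Sb: "S j \<in> convex_bodies" for j using S bodies by blast
    have SG: "S j \<in> galerkin_space A" and Slo: "galerkin_proj A Clo \<subseteq> S j"
      and Shi: "S j \<subseteq> galerkin_proj A Chi" for j
      using S by (auto simp: galerkin_feasible_set_def)
    have "\<Psi> (S j) $ i \<le> \<theta>" for i j
      using S[of j] \<Psi>'[OF Sb[of j]] by (simp add: galerkin_feasible_set_def less_eq_vec_def)
    then have "\<Psi> C $ i \<le> \<theta>" for i
      by (rule lipschitz_H_limit_le[OF \<Psi> Sb C lim _ tendsto_const])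
    then have "\<Psi>' C \<le> 0" by (simp add: \<Psi>'[OF C] less_eq_vec_def)
    moreover have "galerkin_proj A Clo \<subseteq> C"
      by (rule hausdorff_limit_mono[OF P[OF Clo] hausdorff_limit_const Sb lim convex_bodiesD(4)[OF C] Slo])
         (rule convex_bodiesD(1)[OF P[OF Clo]])
    moreover have "C \<subseteq> galerkin_proj A Chi"
      by (rule hausdorff_limit_mono[OF Sb lim P[OF Chi] hausdorff_limit_const convex_bodiesD(4)[OF P[OF Chi]] Shi])
         (rule convex_bodiesD(1)[OF P[OF Chi]])
    ultimately show ?thesis
      using galerkin_space_closed[OF SG Sb C lim A] by (simp add: galerkin_feasible_set_def)
  qed
  show "\<exists>C\<in>?M. \<exists>r. strict_mono r \<and> (\<lambda>j. dist_H (S (r j)) C) \<longlonglongrightarrow> 0"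
    if "\<And>j. S j \<in> ?M" for S :: "nat \<Rightarrow> (real^'d) set"
  proof (rule convex_body_family_compact[OF bodies _ convex_bodiesD(5)[OF P[OF Chi]]])
    show "C \<subseteq> galerkin_proj A Chi" if "C \<in> ?M" for C
      using that by (simp add: galerkin_feasible_set_def)
  qed (fact closed that)+
qed

section \<open>Convergence of the minimizers\<close>

text \<open>The index \<open>j\<close> runs along an arbitrary sequence of matrices, so that the lemma applies to
subsequences. Feasibility of the limit uses that the relaxed constraints converge to the
original ones; optimality compares \<open>S j\<close> with the projections of a competitor \<open>D\<close>.\<close>

lemma galerkin_minimizers_limit:
  fixes A :: "nat \<Rightarrow> (real^'d) list" and K :: "nat \<Rightarrow> real"
  assumes A: "\<And>j. normalized_matrix (A j)" and K: "\<And>j. galerkin_kappa (A j) \<le> ereal (K j)" "K \<longlonglongrightarrow> 0"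
    and \<Phi>: "continuous_H \<Phi>" and \<Psi>: "lipschitz_H L \<Psi>"
    and Clo: "Clo \<in> convex_bodies" and Chi: "Chi \<in> convex_bodies"
    and \<Psi>': "\<And>j C. C \<in> convex_bodies \<Longrightarrow> \<Psi>' j C = \<Psi> C - (L * K j * set_norm Chi) *\<^sub>R 1"
    and unif: "\<And>e. e > 0 \<Longrightarrow> \<forall>\<^sub>F j in sequentially.
      \<forall>C\<in>galerkin_feasible_set (A j) (\<Psi>' j) Clo Chi. \<bar>\<Phi> C - \<Phi>' j C\<bar> < e"
    and S: "\<And>j. S j \<in> argmin_set (\<Phi>' j) (galerkin_feasible_set (A j) (\<Psi>' j) Clo Chi)"
    and C: "C \<in> convex_bodies" and lim: "(\<lambda>j. dist_H (S j) C) \<longlonglongrightarrow> 0"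
  shows "C \<in> argmin_set \<Phi> (feasible_set \<Psi> Clo Chi)"
proof -
  define M where "M = (\<lambda>j. galerkin_feasible_set (A j) (\<Psi>' j) Clo Chi)"
  note P = galerkin_proj_convex_body[OF A _ K(1)]
  have P_lim: "(\<lambda>j. dist_H (galerkin_proj (A j) D) D) \<longlonglongrightarrow> 0" if D: "D \<in> convex_bodies" for D
  proof (subst dist_H_tendsto_0_iff)
    show "galerkin_proj (A j) D \<noteq> {}" for j
      by (rule convex_bodiesD(1)[OF P[OF D]])
    show "\<forall>e>0. \<forall>\<^sub>F j in sequentially. hausdorff_within e (galerkin_proj (A j) D) D"
    proof (intro allI impI)
      fix e :: real assume e: "e > 0"
      have "(\<lambda>j. K j * set_norm D) \<longlonglongrightarrow> 0"
        using tendsto_mult_right[OF K(2), of "set_norm D"] by simp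
      then have "\<forall>\<^sub>F j in sequentially. K j * set_norm D < e"
        using e by (rule order_tendstoD)
      then show "\<forall>\<^sub>F j in sequentially. hausdorff_within e (galerkin_proj (A j) D) D"
      proof eventually_elim
        case (elim j)
        then show ?case
          using hausdorff_within_mono[OF galerkin_proj_error[OF A D K(1)[of j]], of e]
          by (simp add: hausdorff_within_sym[of e D])
      qed
    qed
  qed
  have SM: "S j \<in> M j" and S_min: "\<And>D. D \<in> M j \<Longrightarrow> \<Phi>' j (S j) \<le> \<Phi>' j D" for j
    using S[of j] by (auto simp: argmin_set_iff M_def)
  have Sb: "S j \<in> convex_bodies" for j
    using SM galerkin_feasible_set_convex_bodies[OF A Chi K(1)] unfolding M_def by blast
  have "C \<in> feasible_set \<Psi> Clo Chi"
  proof -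
    have \<Psi>S: "\<Psi> (S j) $ i \<le> L * K j * set_norm Chi" for i j
      using SM[of j] \<Psi>'[OF Sb] by (simp add: M_def galerkin_feasible_set_def less_eq_vec_def)
    have "(\<lambda>j. L * K j * set_norm Chi) \<longlonglongrightarrow> L * 0 * set_norm Chi"
      by (intro tendsto_intros K)
    then have c: "(\<lambda>j. L * K j * set_norm Chi) \<longlonglongrightarrow> 0" by simp
    have "\<Psi> C $ i \<le> 0" for i
      by (rule lipschitz_H_limit_le[OF \<Psi> Sb C lim \<Psi>S c])
    moreover have "Clo \<subseteq> C"
    proof (rule hausdorff_limit_mono[OF P[OF Clo] P_lim[OF Clo] Sb lim convex_bodiesD(4)[OF C]])
      show "galerkin_proj (A j) Clo \<subseteq> S j" for j
        using SM[of j] by (simp add: M_def galerkin_feasible_set_def)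
    qed
    moreover have "C \<subseteq> Chi"
    proof (rule hausdorff_limit_mono[OF Sb lim P[OF Chi] P_lim[OF Chi] convex_bodiesD(4)[OF Chi]])
      show "S j \<subseteq> galerkin_proj (A j) Chi" for j
        using SM[of j] by (simp add: M_def galerkin_feasible_set_def)
    qed
    ultimately show ?thesis using C by (simp add: feasible_set_def less_eq_vec_def)
  qed
  moreover have "\<Phi> C \<le> \<Phi> D" if D: "D \<in> feasible_set \<Psi> Clo Chi" for D
  proof (rule field_le_epsilon)
    fix e :: real assume e: "e > 0"
    have Db: "D \<in> convex_bodies" using D by (simp add: feasible_set_def)
    have PM: "galerkin_proj (A j) D \<in> M j" for j
      unfolding M_def by (rule galerkin_proj_feasible[OF A K(1) \<Psi> Clo Chi \<Psi>' D])
    have "\<forall>\<^sub>F j in sequentially. \<Phi> (S j) \<le> \<Phi> (galerkin_proj (A j) D) + e"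
      using unif[OF half_gt_zero[OF e]]
    proof eventually_elim
      case (elim j)
      then have "\<bar>\<Phi> (S j) - \<Phi>' j (S j)\<bar> < e/2"
          "\<bar>\<Phi> (galerkin_proj (A j) D) - \<Phi>' j (galerkin_proj (A j) D)\<bar> < e/2"
        using SM PM by (auto simp: M_def)
      then show ?case using S_min[OF PM] by (smt (verit) field_sum_of_halves)
    qed
    moreover have "(\<lambda>j. \<Phi> (S j)) \<longlonglongrightarrow> \<Phi> C"
      by (rule continuous_H_tendsto[OF \<Phi> Sb C lim])
    moreover have "(\<lambda>j. \<Phi> (galerkin_proj (A j) D) + e) \<longlonglongrightarrow> \<Phi> D + e"
      by (rule tendsto_add[OF continuous_H_tendsto[OF \<Phi> P[OF Db] Db P_lim[OF Db]] tendsto_const])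
    ultimately show "\<Phi> C \<le> \<Phi> D + e"
      using tendsto_le[OF sequentially_bot] by blast
  qed
  ultimately show ?thesis by (simp add: argmin_set_iff)
qed

theorem theorem52:
  fixes \<Phi> :: "(real^'d) set \<Rightarrow> real"
    and \<Phi>k :: "nat \<Rightarrow> (real^'d) set \<Rightarrow> real"
    and \<Psi> :: "(real^'d) set \<Rightarrow> real^'m"
    and \<Psi>k :: "nat \<Rightarrow> (real^'d) set \<Rightarrow> real^'m"
    and L :: real
    and Clo Chi :: "(real^'d) set"
    and A :: "nat \<Rightarrow> (real^'d) list"
  assumes "continuous_H \<Phi>"
    and "lipschitz_H L \<Psi>"
    and "Clo \<in> convex_bodies" and "Chi \<in> convex_bodies"
    and "nested_galerkin A"
    and "\<And>k. lsc_H (\<Phi>k k)"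
    and "(\<lambda>k. SUP C\<in>galerkin_feasible_set (A k) (\<Psi>k k) Clo Chi. ereal \<bar>\<Phi> C - \<Phi>k k C\<bar>)
           \<longlonglongrightarrow> 0"
    and "\<And>k C. C \<in> convex_bodies \<Longrightarrow>
           \<Psi>k k C = \<Psi> C - (L * real_of_ereal (galerkin_kappa (A k)) * set_norm Chi) *\<^sub>R 1"
    and "feasible_set \<Psi> Clo Chi \<noteq> {}"
  shows "argmin_set \<Phi> (feasible_set \<Psi> Clo Chi) \<noteq> {} \<and>
         (\<lambda>k. excess_H (argmin_set (\<Phi>k k) (galerkin_feasible_set (A k) (\<Psi>k k) Clo Chi))
                       (argmin_set \<Phi> (feasible_set \<Psi> Clo Chi))) \<longlonglongrightarrow> 0"
proof
  note \<Phi> = assms(1) and \<Psi> = assms(2) and Clo = assms(3) and Chi = assms(4)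
  define K where "K = (\<lambda>k. real_of_ereal (galerkin_kappa (A k)))"
  define M where "M = (\<lambda>k. galerkin_feasible_set (A k) (\<Psi>k k) Clo Chi)"
  define min_k where "min_k = (\<lambda>k. argmin_set (\<Phi>k k) (M k))"
  define min_lim where "min_lim = argmin_set \<Phi> (feasible_set \<Psi> Clo Chi)"
  have A: "normalized_matrix (A k)" for k
    using assms(5) by (simp add: nested_galerkin_def)
  have kappa_lim: "(\<lambda>k. galerkin_kappa (A k)) \<longlonglongrightarrow> ereal 0"
    using nested_galerkin_kappa_tendsto_0[OF assms(5)] by (simp only: zero_ereal_def)
  have K_lim: "K \<longlonglongrightarrow> 0"
    unfolding K_def using kappa_lim by (rule lim_real_of_ereal)
  have \<Psi>k: "\<Psi>k k C = \<Psi> C - (L * K k * set_norm Chi) *\<^sub>R 1" if "C \<in> convex_bodies" for k C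
    unfolding K_def by (rule assms(8)[OF that])
  have unif: "\<forall>\<^sub>F k in sequentially. \<forall>C\<in>M k. \<bar>\<Phi> C - \<Phi>k k C\<bar> < e" if "e > 0" for e
  proof -
    have "\<forall>\<^sub>F k in sequentially. (SUP C\<in>M k. ereal \<bar>\<Phi> C - \<Phi>k k C\<bar>) < ereal e"
      using order_tendstoD(2)[OF assms(7), of "ereal e"] that by (simp add: M_def)
    then show ?thesis
    proof eventually_elim
      case (elim k)
      have "ereal \<bar>\<Phi> C - \<Phi>k k C\<bar> \<le> (SUP C\<in>M k. ereal \<bar>\<Phi> C - \<Phi>k k C\<bar>)" if "C \<in> M k" for C
        using that by (rule SUP_upper)
      from le_less_trans[OF this elim] show ?case by simp
    qed
  qed
  have "\<forall>\<^sub>F k in sequentially. galerkin_kappa (A k) < ereal 1"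
    using kappa_lim by (rule order_tendstoD) simp
  \<comment> \<open>From \<open>k0\<close> on the error constant is finite, hence equal to its real part \<open>K k\<close>, and the bound \<open>1\<close> yields a ball that contains all later feasible bodies.\<close>
  then obtain k0 where k0: "\<And>k. k \<ge> k0 \<Longrightarrow> galerkin_kappa (A k) < ereal 1"
    by (auto simp: eventually_sequentially)
  have K: "galerkin_kappa (A k) \<le> ereal (K k)" if "k \<ge> k0" for k
    using k0[OF that] galerkin_kappa_nonneg[of "A k"] unfolding K_def
    by (cases "galerkin_kappa (A k)") auto
  show nonempty: "argmin_set \<Phi> (feasible_set \<Psi> Clo Chi) \<noteq> {}"
    by (rule argmin_feasible_set_nonempty[OF \<Phi> \<Psi> Clo Chi assms(9)])
  have O_nonempty: "min_k k \<noteq> {}" if "k \<ge> k0" for k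
  proof -
    obtain D where "D \<in> feasible_set \<Psi> Clo Chi" using assms(9) by blast
    then have "M k \<noteq> {}"
      using galerkin_proj_feasible[OF A K[OF that] \<Psi> Clo Chi \<Psi>k] unfolding M_def by blast
    then show ?thesis
      unfolding min_k_def M_def
      by (intro argmin_galerkin_feasible_set_nonempty[where L = L and \<Psi> = \<Psi> and K = "K k"
            and \<theta> = "L * K k * set_norm Chi"] A K that assms(6) \<Psi> Clo Chi \<Psi>k)
  qed
  have bodies: "D \<in> convex_bodies" "D \<subseteq> cball 0 (2 * set_norm Chi)" if "k \<ge> k0" "D \<in> min_k k" for k D
  proof -
    have DM: "D \<in> M k" using that(2) by (simp add: min_k_def argmin_set_iff)
    then show "D \<in> convex_bodies"
      using galerkin_feasible_set_convex_bodies[OF A Chi K[OF that(1)]] unfolding M_def by blast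
    have error: "hausdorff_within (1 * set_norm Chi) Chi (galerkin_proj (A k) Chi)"
      by (rule galerkin_proj_error[OF A Chi less_imp_le[OF k0[OF that(1)]]])
    show "D \<subseteq> cball 0 (2 * set_norm Chi)"
    proof
      fix x assume "x \<in> D"
      then have "x \<in> galerkin_proj (A k) Chi"
        using DM by (auto simp: M_def galerkin_feasible_set_def)
      then obtain y where y: "y \<in> Chi" "dist y x \<le> 1 * set_norm Chi"
        using error unfolding hausdorff_within_def by blast
      then show "x \<in> cball 0 (2 * set_norm Chi)"
        using norm_le_set_norm[OF Chi y(1)] norm_triangle_ineq2[of x y]
        by (simp add: dist_norm norm_minus_commute)
    qed
  qed
  have upper: "\<forall>\<^sub>F k in sequentially. excess_H (min_k k) min_lim \<le> ereal e" if e: "e > 0" for e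
  proof (rule ccontr)
    assume contr: "\<not> ?thesis"
    have "\<not> (\<forall>\<^sub>F k in sequentially. k \<ge> k0 \<longrightarrow> excess_H (min_k k) min_lim \<le> ereal e)"
    proof
      assume "\<forall>\<^sub>F k in sequentially. k \<ge> k0 \<longrightarrow> excess_H (min_k k) min_lim \<le> ereal e"
      with eventually_ge_at_top[of k0] have "\<forall>\<^sub>F k in sequentially. excess_H (min_k k) min_lim \<le> ereal e"
        by eventually_elim simp
      with contr show False by simp
    qed
    then obtain q where q: "strict_mono (q :: nat \<Rightarrow> nat)" and q_ge: "\<And>j. q j \<ge> k0"
      and "\<And>j. ereal e < excess_H (min_k (q j)) min_lim"
      using not_eventually_sequentiallyD[of "\<lambda>k. k \<ge> k0 \<longrightarrow> excess_H (min_k k) min_lim \<le> ereal e"]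
      by (auto simp: not_le)
    then have "\<forall>j. \<exists>D. D \<in> min_k (q j) \<and> ereal e < (INF D'\<in>min_lim. dist_H D D')"
      unfolding excess_H_def less_SUP_iff by blast
    from choice[OF this] obtain S where S: "\<And>j. S j \<in> min_k (q j)"
      and far: "\<And>j. ereal e < (INF D'\<in>min_lim. dist_H (S j) D')"
      by blast
    obtain C r where C: "C \<in> convex_bodies" and r: "strict_mono (r :: nat \<Rightarrow> nat)"
      and lim: "(\<lambda>j. dist_H (S (r j)) C) \<longlonglongrightarrow> 0"
      by (rule blaschke_selection[OF bodies[OF q_ge S]])
    define p where "p = (\<lambda>j. q (r j))"
    have p: "filterlim p sequentially sequentially"
      unfolding p_def using filterlim_compose[OF filterlim_subseq[OF q] filterlim_subseq[OF r]] .
    have "C \<in> min_lim"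
      unfolding min_lim_def
    proof (rule galerkin_minimizers_limit[where A = "\<lambda>j. A (p j)" and K = "\<lambda>j. K (p j)"
          and \<Psi>' = "\<lambda>j. \<Psi>k (p j)" and \<Phi>' = "\<lambda>j. \<Phi>k (p j)" and S = "\<lambda>j. S (r j)", OF A _ _ \<Phi> \<Psi> Clo Chi \<Psi>k _ _ C lim])
      show "galerkin_kappa (A (p j)) \<le> ereal (K (p j))" for j
        unfolding p_def by (rule K[OF q_ge])
      show "(\<lambda>j. K (p j)) \<longlonglongrightarrow> 0"
        by (rule filterlim_compose[OF K_lim p])
      show "\<forall>\<^sub>F j in sequentially.
          \<forall>C\<in>galerkin_feasible_set (A (p j)) (\<Psi>k (p j)) Clo Chi. \<bar>\<Phi> C - \<Phi>k (p j) C\<bar> < e" if "e > 0" for e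
        using eventually_compose_filterlim[OF unif[OF that] p] by (simp add: M_def)
      show "S (r j) \<in> argmin_set (\<Phi>k (p j)) (galerkin_feasible_set (A (p j)) (\<Psi>k (p j)) Clo Chi)" for j
        using S[of "r j"] by (simp add: min_k_def M_def p_def)
    qed
    have "\<forall>\<^sub>F j in sequentially. dist_H (S (r j)) C < ereal e"
      using order_tendstoD(2)[OF lim, of "ereal e"] e by simp
    then obtain j where j: "dist_H (S (r j)) C < ereal e"
      using eventually_happens'[OF sequentially_bot] by blast
    have "(INF D'\<in>min_lim. dist_H (S (r j)) D') \<le> dist_H (S (r j)) C"
      using \<open>C \<in> min_lim\<close> by (rule INF_lower)
    also note j
    finally show False using far[of "r j"] by simp
  qed
  have lower: "0 \<le> excess_H (min_k k) min_lim" if k: "k \<ge> k0" for k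
  proof -
    obtain D where D: "D \<in> min_k k" using O_nonempty[OF k] by blast
    have "0 \<le> (INF D'\<in>min_lim. dist_H D D')"
      using convex_bodiesD(1)[OF bodies(1)[OF k D]] by (intro INF_greatest dist_H_nonneg)
    also have "\<dots> \<le> excess_H (min_k k) min_lim"
      unfolding excess_H_def using D by (rule SUP_upper)
    finally show ?thesis .
  qed
  have "(\<lambda>k. excess_H (min_k k) min_lim) \<longlonglongrightarrow> 0"
  proof (rule order_tendstoI)
    fix a :: ereal assume "a < 0"
    then show "\<forall>\<^sub>F k in sequentially. a < excess_H (min_k k) min_lim"
      using lower by (intro eventually_sequentiallyI[of k0]) (meson less_le_trans)
  next
    fix a :: ereal assume "0 < a"
    then obtain e where e: "0 < ereal e" "ereal e < a"
      using ereal_dense2 by blast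
    then have "\<forall>\<^sub>F k in sequentially. excess_H (min_k k) min_lim \<le> ereal e"
      using upper by simp
    then show "\<forall>\<^sub>F k in sequentially. excess_H (min_k k) min_lim < a"
      by (rule eventually_mono) (use e(2) le_less_trans in blast)
  qed
  then show "(\<lambda>k. excess_H (argmin_set (\<Phi>k k) (galerkin_feasible_set (A k) (\<Psi>k k) Clo Chi))
                       (argmin_set \<Phi> (feasible_set \<Psi> Clo Chi))) \<longlonglongrightarrow> 0"
    by (simp add: min_k_def min_lim_def M_def)
qed

end
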